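(* Let $n$ be a positive odd integer, and for $k\geqslant 0$ let $$c_q(k)=\frac{(q;q^2)_k^2(q^2;q^4)_k}{(q^2;q^2)_k^2(q^4;q^4)_k}q^{2k}.$$ Then, modulo $\Phi_n(q)^3$, $$\sum_{k=0}^{n-1}\sum_{j=0}^{k}c_q(j)c_q(k-j)\equiv \begin{cases} \dfrac{(q^2;q^4)_{(n-1)/4}^4}{(q^4;q^4)_{(n-1)/4}^4}q^{n-1} \left(1+4[n]^2\displaystyle\sum_{k=1}^{(n-1)/4}\frac{q^{4k-2}}{[4k-2]^2}\right) & \text{if } n\equiv 1\pmod 4,\\[10pt] 0 & \text{if } n\equiv 3\pmod 4. \end{cases}$$
   Context: Here $q$ is an indeterminate. The $q$-shifted factorial is $(x;q)_0=1$ and $(x;q)_m=(1-x)(1-xq)\cdots(1-xq^{m-1})$ for $m\geqslant1$; the $q$-integer is $[m]=1+q+\cdots+q^{m-1}$. $\Phi_n(q)$ is the $n$-th cyclotomic polynomial. For rational functions $A,B$ in $q$ and a polynomial $P$, $A\equiv B\pmod{P}$ means that $A-B=P\cdot U/V$ for polynomials $U,V$ with $V$ coprime to $P$. *)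

theory Defs
  imports
    Complex_Main
    "HOL-Computational_Algebra.Computational_Algebra"
begin

(* The ground field is the rationals: polynomials in q are "rat poly" and rational functions
   in q are "rat poly fract". *)

definition q :: "rat poly fract" where
  "q = to_fract [:0, 1:]"

definition qpoch :: "'a::comm_ring_1 \<Rightarrow> 'a \<Rightarrow> nat \<Rightarrow> 'a" where
  "qpoch x b m = (\<Prod>i<m. 1 - x * b ^ i)"

definition qint :: "nat \<Rightarrow> rat poly fract" where
  "qint m = (\<Sum>i<m. q ^ i)"

definition cq :: "nat \<Rightarrow> rat poly fract" where
  "cq k = ((qpoch q (q^2) k)^2 * qpoch (q^2) (q^4) k) /
          ((qpoch (q^2) (q^2) k)^2 * qpoch (q^4) (q^4) k) * q ^ (2 * k)"

(* V \<noteq> 0 is stated because x / 0 = 0 in a HOL field. *)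
definition qcong :: "rat poly fract \<Rightarrow> rat poly fract \<Rightarrow> rat poly \<Rightarrow> bool" where
  "qcong A B P \<longleftrightarrow>
     (\<exists>U V :: rat poly. V \<noteq> 0 \<and> coprime V P \<and>
        A - B = to_fract P * to_fract U / to_fract V)"

(* Obtained by solving q^n - 1 = (product of the n-th cyclotomic polynomials over all divisors
   d of n) for the factor d = n; the division is exact for n > 0. See map_poly_cyclotomic below
   for the description by primitive roots of unity. *)
function cyclotomic :: "nat \<Rightarrow> rat poly" where
  "cyclotomic n = (monom 1 n - 1) div (\<Prod>d\<in>{d. d dvd n \<and> d < n}. cyclotomic d)"
  by auto
termination by (relation "measure id") auto

declare cyclotomic.simps [simp del]

definition primitive_roots :: "nat \<Rightarrow> complex set" where
  "primitive_roots n = {z. z ^ n = 1 \<and> (\<forall>k. 0 < k \<and> k < n \<longrightarrow> z ^ k \<noteq> 1)}"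

lemma finite_primitive_roots: "n > 0 \<Longrightarrow> finite (primitive_roots n)"
  by (rule finite_subset[OF _ finite_roots_unity[of n]]) (auto simp: primitive_roots_def)

lemma primitive_roots_power_eq_1_iff:
  assumes "z \<in> primitive_roots d" "d > 0"
  shows "z ^ n = 1 \<longleftrightarrow> d dvd n"
proof -
  have zd: "z ^ d = 1" using assms by (simp add: primitive_roots_def)
  have "z ^ n = z ^ (d * (n div d) + n mod d)" by simp
  also have "\<dots> = z ^ (n mod d)" by (simp only: power_add power_mult zd power_one mult_1_left)
  finally have eq: "z ^ n = z ^ (n mod d)" .
  show ?thesis
  proof
    assume "z ^ n = 1"
    with eq have "z ^ (n mod d) = 1" by simp
    moreover have "n mod d < d" using assms(2) by simp
    ultimately have "n mod d = 0" using assms(1) by (auto simp: primitive_roots_def)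
    thus "d dvd n" by auto
  next
    assume "d dvd n"
    thus "z ^ n = 1" using eq by simp
  qed
qed

lemma roots_unity_partition:
  assumes "n > 0"
  shows "{z::complex. z ^ n = 1} = (\<Union>d\<in>{d. d dvd n}. primitive_roots d)"
proof (intro equalityI subsetI)
  fix z :: complex assume "z \<in> {z. z ^ n = 1}"
  hence ex: "0 < n \<and> z ^ n = 1" using assms by simp
  define d where "d = (LEAST d. 0 < d \<and> z ^ d = 1)"
  have d: "0 < d \<and> z ^ d = 1" unfolding d_def by (rule LeastI[of "\<lambda>d. 0 < d \<and> z ^ d = 1", OF ex])
  have z: "z \<in> primitive_roots d"
    using d not_less_Least[of _ "\<lambda>d. 0 < d \<and> z ^ d = 1"]
    by (auto simp: primitive_roots_def d_def)
  have "d dvd n" using primitive_roots_power_eq_1_iff[OF z] d ex by blast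
  with z show "z \<in> (\<Union>d\<in>{d. d dvd n}. primitive_roots d)" by auto
next
  fix z assume "z \<in> (\<Union>d\<in>{d. d dvd n}. primitive_roots d)"
  then obtain d where d: "d dvd n" "z \<in> primitive_roots d" by auto
  moreover have "d > 0" using d assms by (auto intro: Nat.gr0I)
  ultimately show "z \<in> {z. z ^ n = 1}" using primitive_roots_power_eq_1_iff by blast
qed

lemma prod_roots_unity:
  assumes "n > 0"
  shows "(\<Prod>z\<in>{z::complex. z ^ n = 1}. [:-z, 1:]) = monom 1 n - 1"
proof -
  let ?p = "monom 1 n - 1 :: complex poly"
  have "rsquarefree ?p"
    using assms by (auto simp: rsquarefree_roots poly_monom pderiv_diff pderiv_monom power_0_left)
  from complex_poly_decompose_rsquarefree[OF this]
  have "smult (lead_coeff ?p) (\<Prod>z | poly ?p z = 0. [:-z, 1:]) = ?p" .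
  moreover have "lead_coeff ?p = 1"
  proof -
    have "degree ?p = n"
      using assms by (intro antisym degree_le le_degree) (auto simp: coeff_1)
    thus ?thesis using assms by (simp add: coeff_1)
  qed
  moreover have "{z. poly ?p z = 0} = {z. z ^ n = 1}" by (auto simp: poly_monom)
  ultimately show ?thesis by simp
qed

lemma map_poly_cyclotomic:
  assumes "n > 0"
  shows "map_poly of_rat (cyclotomic n) = (\<Prod>z\<in>primitive_roots n. [:-z, 1:])"
  using assms
proof (induction n rule: less_induct)
  case (less n)
  define h :: "rat poly \<Rightarrow> complex poly" where "h = map_poly of_rat"
  define R where "R d = (\<Prod>z\<in>primitive_roots d. [:-z, 1:])" for d
  have h_add: "h (a + b) = h a + h b" for a b
    by (simp add: h_def poly_eq_iff coeff_map_poly of_rat_add)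
  have h_mult: "h (a * b) = h a * h b" for a b
    by (simp add: h_def poly_eq_iff coeff_map_poly coeff_mult of_rat_sum of_rat_mult)
  have h_1: "h 1 = 1" by (simp add: h_def)
  have h_prod: "h (\<Prod>d\<in>A. f d) = (\<Prod>d\<in>A. h (f d))" for A and f :: "nat \<Rightarrow> rat poly"
    by (induction A rule: infinite_finite_induct) (auto simp: h_mult h_1)
  have h_deg: "degree (h a) = degree a" for a
    unfolding h_def by (rule degree_map_poly) auto
  have h_0: "h a = 0 \<longleftrightarrow> a = 0" for a
    by (simp add: h_def poly_eq_iff coeff_map_poly)
  have h_X: "h (monom 1 n - 1) = monom 1 n - 1"
    by (simp add: h_def poly_eq_iff coeff_map_poly of_rat_diff coeff_1)
  define B where "B = (\<Prod>d\<in>{d. d dvd n \<and> d < n}. cyclotomic d)"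
  define a :: "rat poly" where "a = monom 1 n - 1"
  have fin: "finite {d. d dvd n}" using less.prems by simp
  have "h B = (\<Prod>d\<in>{d. d dvd n \<and> d < n}. h (cyclotomic d))"
    unfolding B_def by (rule h_prod)
  also have "\<dots> = (\<Prod>d\<in>{d. d dvd n \<and> d < n}. R d)"
  proof (rule prod.cong)
    fix d assume "d \<in> {d. d dvd n \<and> d < n}"
    moreover from this have "d > 0" using less.prems by (auto intro: Nat.gr0I)
    ultimately show "h (cyclotomic d) = R d" using less.IH by (auto simp: h_def R_def)
  qed auto
  finally have hB: "h B = (\<Prod>d\<in>{d. d dvd n \<and> d < n}. R d)" .
  have pos: "0 < d" if "d dvd n" for d using that less.prems by (auto intro: Nat.gr0I)
  have "h a = (\<Prod>z\<in>(\<Union>d\<in>{d. d dvd n}. primitive_roots d). [:-z, 1:])"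
    using prod_roots_unity[OF less.prems] roots_unity_partition[OF less.prems]
    by (simp add: a_def h_X)
  also have "\<dots> = (\<Prod>d\<in>{d. d dvd n}. R d)"
    unfolding R_def
  proof (rule prod.UNION_disjoint)
    show "\<forall>d\<in>{d. d dvd n}. \<forall>e\<in>{d. d dvd n}. d \<noteq> e \<longrightarrow> primitive_roots d \<inter> primitive_roots e = {}"
    proof (intro ballI impI)
      fix d e assume de: "d \<in> {d. d dvd n}" "e \<in> {d. d dvd n}" "d \<noteq> e"
      have "False" if z: "z \<in> primitive_roots d" "z \<in> primitive_roots e" for z
      proof -
        have "z ^ d = 1" "z ^ e = 1"
          using z by (simp_all add: primitive_roots_def)
        moreover have "0 < d" "0 < e"
          using de pos by simp_all
        ultimately have "d dvd e" "e dvd d"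
          using primitive_roots_power_eq_1_iff[OF z(1)] primitive_roots_power_eq_1_iff[OF z(2)]
          by blast+
        with de show False by (simp add: dvd_antisym)
      qed
      thus "primitive_roots d \<inter> primitive_roots e = {}" by auto
    qed
  qed (use fin pos finite_primitive_roots in auto)
  also have "{d. d dvd n} = insert n {d. d dvd n \<and> d < n}"
    using less.prems by (auto dest: dvd_imp_le)
  also have "(\<Prod>d\<in>insert n {d. d dvd n \<and> d < n}. R d) = R n * h B"
    unfolding hB by (subst prod.insert) auto
  finally have ha: "h a = R n * h B" .
  have "a \<noteq> 0"
  proof
    assume "a = 0"
    hence "coeff a n = 0" by simp
    thus False using less.prems by (simp add: a_def coeff_1)
  qed
  hence B0: "h B \<noteq> 0" using ha h_0 by force
  have "a = B * (a div B) + a mod B" by simp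
  hence "h a = h B * h (a div B) + h (a mod B)" by (metis h_add h_mult)
  hence eq: "h (a mod B) = h B * (R n - h (a div B))" using ha by (simp add: algebra_simps)
  have "h (a mod B) = 0"
  proof (rule ccontr)
    assume nz: "h (a mod B) \<noteq> 0"
    hence "R n - h (a div B) \<noteq> 0" using eq by auto
    hence "degree (h (a mod B)) = degree (h B) + degree (R n - h (a div B))"
      using eq B0 by (simp add: degree_mult_eq)
    moreover have "degree (a mod B) < degree B"
      using degree_mod_less[of B a] B0 nz h_0 by auto
    ultimately show False by (simp add: h_deg)
  qed
  hence "R n = h (a div B)" using eq B0 by simp
  moreover have "cyclotomic n = a div B"
    unfolding a_def B_def by (rule cyclotomic.simps)
  ultimately show ?case by (simp add: h_def R_def)
qed

end

theory Submission
  imports Defs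
begin

text \<open>
  Every \<open>cq k\<close> with \<open>n/2 < k < n\<close> is divisible by the cube of the cyclotomic polynomial, so the
  double sum is congruent to the square of the partial sum \<open>S\<close> of \<open>cq\<close> up to \<open>(n - 1)/2\<close>.

  Replacing \<open>(q;q\<^sup>2)\<^sub>k\<^sup>2\<close> by \<open>(aq;q\<^sup>2)\<^sub>k (q/a;q\<^sup>2)\<^sub>k\<close> deforms \<open>S\<close> to a polynomial \<open>P\<close> in
  \<open>u = (1 - a)\<^sup>2/a\<close>. At \<open>a = q ^ n\<close> it is summable in closed form, and \<open>u\<close> is then divisible by the
  square of the cyclotomic polynomial, so only the linear coefficient of \<open>P\<close> at a primitive
  \<open>n\<close>-th root of unity \<open>z\<close> is missing. For \<open>n = 4 r + 1\<close> the recurrence behind the closed form,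
  taken at \<open>q = z\<close>, shows that \<open>P\<close> has degree at most \<open>2 r\<close> and double zeros at
  \<open>a = z ^ (4 k - 2)\<close> for \<open>k = 1, ..., r\<close>; the linear coefficient is the logarithmic derivative
  of the resulting product. For \<open>n = 4 r + 3\<close> the closed form is \<open>0\<close> and no more is needed.
\<close>

section \<open>Congruences modulo powers of a cyclotomic polynomial\<close>

definition cpoly :: "rat poly \<Rightarrow> complex \<Rightarrow> complex" where
  "cpoly p z = poly (map_poly of_rat p) z"

lemma map_poly_of_rat_add: "map_poly of_rat (a + b) = (map_poly of_rat a + map_poly of_rat b :: complex poly)"
  by (simp add: poly_eq_iff coeff_map_poly of_rat_add)

lemma map_poly_of_rat_mult: "map_poly of_rat (a * b) = (map_poly of_rat a * map_poly of_rat b :: complex poly)"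
  by (simp add: poly_eq_iff coeff_map_poly coeff_mult of_rat_sum of_rat_mult)

lemma map_poly_of_rat_eq_0_iff: "(map_poly of_rat a :: complex poly) = 0 \<longleftrightarrow> a = 0"
  by (simp add: poly_eq_iff coeff_map_poly)

lemma cpoly_simps [simp]:
  "cpoly (a + b) z = cpoly a z + cpoly b z"
  "cpoly (a * b) z = cpoly a z * cpoly b z"
  "cpoly [:c, d:] z = of_rat c + of_rat d * z"
  "cpoly 1 z = 1" "cpoly 0 z = 0"
  by (simp_all add: cpoly_def map_poly_of_rat_add map_poly_of_rat_mult map_poly_pCons mult.commute)

lemma cpoly_power [simp]: "cpoly (a ^ j) z = cpoly a z ^ j"
  by (induction j) simp_all

lemma cpoly_diff [simp]: "cpoly (a - b) z = cpoly a z - cpoly b z"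
  using cpoly_simps(1)[of "a - b" b z] by simp

text \<open>Dividing out one factor leaves the order at the other, distinct points unchanged, so the
  remaining powers still divide the quotient.\<close>

lemma prod_linear_power_dvd:
  fixes p :: "'a :: idom poly"
  assumes "finite S" "\<And>s. s \<in> S \<Longrightarrow> [:- f s, 1:] ^ e dvd p" "inj_on f S"
  shows "(\<Prod>s\<in>S. [:- f s, 1:] ^ e) dvd p"
  using assms
proof (induction S arbitrary: p rule: finite_induct)
  case (insert x S)
  show ?case
  proof (cases "p = 0")
    case False
    from insert.prems obtain r where r: "p = [:- f x, 1:] ^ e * r" by (meson dvdE insertI1)
    have "[:- f s, 1:] ^ e dvd r" if s: "s \<in> S" for s
    proof -
      have "f s \<noteq> f x" using insert s by (auto simp: inj_on_def)
      hence "order (f s) ([:- f x, 1:] ^ e) = 0" by (intro order_0I) simp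
      moreover have "e \<le> order (f s) p" using insert.prems(1)[of s] s False by (simp add: order_divides)
      ultimately show ?thesis using False r by (simp add: order_divides order_mult)
    qed
    hence "(\<Prod>s\<in>S. [:- f s, 1:] ^ e) dvd r" using insert by simp
    thus ?thesis using insert.hyps r by (simp add: mult_dvd_mono)
  qed simp
qed auto

lemma cpoly_cyclotomic_eq_0_iff:
  assumes "n > 0" shows "cpoly (cyclotomic n) z = 0 \<longleftrightarrow> z \<in> primitive_roots n"
  using finite_primitive_roots[OF assms]
  by (simp add: cpoly_def map_poly_cyclotomic[OF assms] poly_prod)

text \<open>Over the complex numbers the cyclotomic polynomial splits into distinct linear factors,
  so divisibility holds there. It passes to the remainder of the rational division, which must be 0
  by its degree.\<close>

lemma cyclotomic_dvdI:
  assumes n: "n > 0" and 0: "\<And>z. z \<in> primitive_roots n \<Longrightarrow> cpoly p z = 0"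
  shows "cyclotomic n dvd p"
proof -
  let ?h = "map_poly of_rat :: rat poly \<Rightarrow> complex poly"
  have "(\<Prod>z\<in>primitive_roots n. [:- z, 1:] ^ 1) dvd ?h p"
    by (rule prod_linear_power_dvd[OF finite_primitive_roots[OF n]])
       (use 0 in \<open>simp_all add: cpoly_def poly_eq_0_iff_dvd\<close>)
  hence d: "?h (cyclotomic n) dvd ?h p" by (simp add: map_poly_cyclotomic[OF n])
  have "?h p = ?h (cyclotomic n) * ?h (p div cyclotomic n) + ?h (p mod cyclotomic n)"
    by (metis map_poly_of_rat_add map_poly_of_rat_mult mult_div_mod_eq)
  with d have d: "?h (cyclotomic n) dvd ?h (p mod cyclotomic n)"
    by (metis dvd_add_right_iff dvd_triv_left)
  have deg: "degree (?h a) = degree a" for a by (rule degree_map_poly) auto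
  have nz: "cyclotomic n \<noteq> 0"
    using map_poly_cyclotomic[OF n] finite_primitive_roots[OF n] map_poly_of_rat_eq_0_iff[of "cyclotomic n"] by auto
  have "p mod cyclotomic n = 0"
  proof (rule ccontr)
    assume a: "p mod cyclotomic n \<noteq> 0"
    hence "degree (cyclotomic n) \<le> degree (p mod cyclotomic n)"
      using dvd_imp_degree_le[OF d] by (simp add: deg map_poly_of_rat_eq_0_iff)
    with degree_mod_less'[OF nz a] show False by simp
  qed
  thus ?thesis by auto
qed

text \<open>A common divisor that is not a unit has positive degree, hence a complex root; this
  would be a primitive root of unity at which \<open>V\<close> vanishes.\<close>

lemma coprime_cyclotomicI:
  assumes n: "n > 0" and V: "V \<noteq> 0" and nz: "\<And>z. z \<in> primitive_roots n \<Longrightarrow> cpoly V z \<noteq> 0"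
  shows "coprime V (cyclotomic n ^ j)"
proof (rule coprimeI)
  fix d assume d: "d dvd V" "d dvd cyclotomic n ^ j"
  show "is_unit d"
  proof (rule ccontr)
    assume "\<not> is_unit d"
    moreover have "d \<noteq> 0" using d V by auto
    ultimately have "degree d \<noteq> 0" by (simp add: is_unit_iff_degree)
    hence "degree (map_poly of_rat d :: complex poly) \<noteq> 0" by (subst degree_map_poly) auto
    then obtain z :: complex where z: "cpoly d z = 0"
      unfolding cpoly_def using fundamental_theorem_of_algebra constant_degree by metis
    have "cpoly V z = 0" using d(1) z by (auto elim!: dvdE)
    moreover have "cpoly (cyclotomic n ^ j) z = 0" using d(2) z unfolding dvd_def by (metis cpoly_simps(2) mult_zero_left)
    ultimately have "cpoly V z = 0" "cpoly (cyclotomic n) z = 0" by auto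
    thus False using nz n by (simp add: cpoly_cyclotomic_eq_0_iff)
  qed
qed

section \<open>Values and valuations of rational functions at primitive roots of unity\<close>

text \<open>\<open>evals n X f\<close>: the rational function \<open>X\<close> has no pole at the primitive \<open>n\<close>-th roots of unity, where it
  takes the values \<open>f\<close>; such \<open>X\<close> form the localisation in which the congruences are computed.\<close>

definition evals :: "nat \<Rightarrow> rat poly fract \<Rightarrow> (complex \<Rightarrow> complex) \<Rightarrow> bool" where
  "evals n X f \<longleftrightarrow> (\<exists>U V. V \<noteq> 0 \<and> X = to_fract U / to_fract V \<and>
     (\<forall>z\<in>primitive_roots n. cpoly V z \<noteq> 0 \<and> f z = cpoly U z / cpoly V z))"

lemma evals_poly: "evals n (to_fract U) (cpoly U)"
  unfolding evals_def by (rule exI[of _ U], rule exI[of _ 1]) simp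

lemma evals_q: "evals n q (\<lambda>z. z)"
proof -
  have "cpoly [:0, 1:] = (\<lambda>z. z)" by (rule ext) simp
  thus ?thesis using evals_poly[of n "[:0, 1:]"] by (simp add: q_def)
qed

lemma evals_0: "evals n 0 (\<lambda>z. 0)" and evals_1: "evals n 1 (\<lambda>z. 1)"
proof -
  have "cpoly 0 = (\<lambda>z. 0)" "cpoly 1 = (\<lambda>z. 1)" by (rule ext, simp)+
  thus "evals n 0 (\<lambda>z. 0)" "evals n 1 (\<lambda>z. 1)"
    using evals_poly[of n 0] evals_poly[of n 1] by simp_all
qed

lemma evals_add:
  assumes "evals n X f" "evals n Y g" shows "evals n (X + Y) (\<lambda>z. f z + g z)"
proof -
  from assms obtain U V U' V' where
    "V \<noteq> 0" "X = to_fract U / to_fract V" "\<forall>z\<in>primitive_roots n. cpoly V z \<noteq> 0 \<and> f z = cpoly U z / cpoly V z"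
    "V' \<noteq> 0" "Y = to_fract U' / to_fract V'" "\<forall>z\<in>primitive_roots n. cpoly V' z \<noteq> 0 \<and> g z = cpoly U' z / cpoly V' z"
    unfolding evals_def by metis
  thus ?thesis unfolding evals_def
    by - (rule exI[of _ "U * V' + U' * V"], rule exI[of _ "V * V'"], auto simp: field_simps)
qed

lemma evals_mult:
  assumes "evals n X f" "evals n Y g" shows "evals n (X * Y) (\<lambda>z. f z * g z)"
proof -
  from assms obtain U V U' V' where
    "V \<noteq> 0" "X = to_fract U / to_fract V" "\<forall>z\<in>primitive_roots n. cpoly V z \<noteq> 0 \<and> f z = cpoly U z / cpoly V z"
    "V' \<noteq> 0" "Y = to_fract U' / to_fract V'" "\<forall>z\<in>primitive_roots n. cpoly V' z \<noteq> 0 \<and> g z = cpoly U' z / cpoly V' z"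
    unfolding evals_def by metis
  thus ?thesis unfolding evals_def
    by - (rule exI[of _ "U * U'"], rule exI[of _ "V * V'"], simp)
qed

lemma evals_uminus:
  assumes "evals n X f" shows "evals n (- X) (\<lambda>z. - f z)"
proof -
  have "cpoly (- 1) = (\<lambda>z. - 1)" using cpoly_diff[of 0 1] by (intro ext) simp
  thus ?thesis using evals_mult[OF evals_poly[of n "- 1"] assms] by simp
qed

lemma evals_diff:
  assumes "evals n X f" "evals n Y g" shows "evals n (X - Y) (\<lambda>z. f z - g z)"
  using evals_add[OF assms(1) evals_uminus[OF assms(2)]] by simp

lemma evals_divide:
  assumes "n > 0" "evals n X f" "evals n Y g" "Y \<noteq> 0" "\<And>z. z \<in> primitive_roots n \<Longrightarrow> g z \<noteq> 0"
  shows "evals n (X / Y) (\<lambda>z. f z / g z)"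
proof -
  from assms obtain U V where V:
    "V \<noteq> 0" "Y = to_fract U / to_fract V" "\<forall>z\<in>primitive_roots n. cpoly V z \<noteq> 0 \<and> g z = cpoly U z / cpoly V z"
    unfolding evals_def by metis
  hence "evals n (1 / Y) (\<lambda>z. 1 / g z)" unfolding evals_def
    using assms(4,5) by - (rule exI[of _ "V"], rule exI[of _ "U"], auto simp: field_simps)
  from evals_mult[OF assms(2) this] show ?thesis by simp
qed

lemma evals_power: "evals n X f \<Longrightarrow> evals n (X ^ k) (\<lambda>z. f z ^ k)"
proof (induction k)
  case 0 show ?case using evals_1 by simp
next
  case (Suc k) show ?case unfolding power_Suc by (rule evals_mult[OF Suc.prems Suc.IH[OF Suc.prems]])
qed

lemma evals_sum:
  assumes "\<And>i. i \<in> I \<Longrightarrow> evals n (X i) (f i)"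
  shows "evals n (\<Sum>i\<in>I. X i) (\<lambda>z. \<Sum>i\<in>I. f i z)"
  using assms
proof (induction I rule: infinite_finite_induct)
  case (insert i I)
  have "evals n (X i) (f i)" "evals n (\<Sum>i\<in>I. X i) (\<lambda>z. \<Sum>i\<in>I. f i z)" using insert by simp_all
  from evals_add[OF this] show ?case using insert by simp
qed (use evals_0 in simp_all)

lemma evals_prod:
  assumes "\<And>i. i \<in> I \<Longrightarrow> evals n (X i) (f i)"
  shows "evals n (\<Prod>i\<in>I. X i) (\<lambda>z. \<Prod>i\<in>I. f i z)"
  using assms
proof (induction I rule: infinite_finite_induct)
  case (insert i I)
  have "evals n (X i) (f i)" "evals n (\<Prod>i\<in>I. X i) (\<lambda>z. \<Prod>i\<in>I. f i z)" using insert by simp_all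
  from evals_mult[OF this] show ?case using insert by simp
qed (use evals_1 in simp_all)

text \<open>A lower bound \<open>j\<close> for the valuation of \<open>X\<close> at the \<open>n\<close>-th cyclotomic polynomial.\<close>

definition cyc_ord :: "nat \<Rightarrow> nat \<Rightarrow> rat poly fract \<Rightarrow> bool" where
  "cyc_ord n j X \<longleftrightarrow> (\<exists>Y f. X = to_fract (cyclotomic n) ^ j * Y \<and> evals n Y f)"

lemma cyc_ord_0I: "evals n X f \<Longrightarrow> cyc_ord n 0 X"
  unfolding cyc_ord_def by (rule exI[of _ X], rule exI[of _ f]) simp

text \<open>This turns pointwise vanishing at roots of unity into a factor of the cyclotomic
  polynomial; higher orders are then obtained from products.\<close>

lemma cyc_ord_1I:
  assumes n: "n > 0" and "evals n X f" "\<And>z. z \<in> primitive_roots n \<Longrightarrow> f z = 0"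
  shows "cyc_ord n 1 X"
proof -
  from assms obtain U V where V:
    "V \<noteq> 0" "X = to_fract U / to_fract V" "\<forall>z\<in>primitive_roots n. cpoly V z \<noteq> 0 \<and> f z = cpoly U z / cpoly V z"
    unfolding evals_def by metis
  hence "cyclotomic n dvd U" using assms(3) by (intro cyclotomic_dvdI[OF n]) force
  then obtain W where W: "U = cyclotomic n * W" by (elim dvdE)
  have "X = to_fract (cyclotomic n) ^ 1 * (to_fract W / to_fract V)" using V W by simp
  moreover have "evals n (to_fract W / to_fract V) (\<lambda>z. cpoly W z / cpoly V z)"
    unfolding evals_def using V by blast
  ultimately show ?thesis unfolding cyc_ord_def by blast
qed

lemma cyc_ord_0: "cyc_ord n j 0"
  unfolding cyc_ord_def by (intro exI[of _ 0] exI[of _ "\<lambda>z. 0"]) (simp add: evals_0)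

lemma cyc_ord_add:
  assumes "cyc_ord n j X" "cyc_ord n j Y" shows "cyc_ord n j (X + Y)"
proof -
  from assms obtain X' Y' f g where "X = to_fract (cyclotomic n) ^ j * X'" "evals n X' f"
    "Y = to_fract (cyclotomic n) ^ j * Y'" "evals n Y' g" unfolding cyc_ord_def by blast
  hence "X + Y = to_fract (cyclotomic n) ^ j * (X' + Y')" "evals n (X' + Y') (\<lambda>z. f z + g z)"
    by (simp_all add: distrib_left evals_add)
  thus ?thesis unfolding cyc_ord_def by blast
qed

lemma cyc_ord_uminus:
  assumes "cyc_ord n j X" shows "cyc_ord n j (- X)"
proof -
  from assms obtain X' f where "X = to_fract (cyclotomic n) ^ j * X'" "evals n X' f"
    unfolding cyc_ord_def by blast
  hence "- X = to_fract (cyclotomic n) ^ j * (- X')" "evals n (- X') (\<lambda>z. - f z)"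
    by (simp_all add: evals_uminus)
  thus ?thesis unfolding cyc_ord_def by blast
qed

lemma cyc_ord_diff: "cyc_ord n j X \<Longrightarrow> cyc_ord n j Y \<Longrightarrow> cyc_ord n j (X - Y)"
  using cyc_ord_add[of n j X "- Y"] cyc_ord_uminus[of n j Y] by simp

lemma cyc_ord_mult:
  assumes "cyc_ord n i X" "cyc_ord n j Y" shows "cyc_ord n (i + j) (X * Y)"
proof -
  from assms obtain X' Y' f g where "X = to_fract (cyclotomic n) ^ i * X'" "evals n X' f"
    "Y = to_fract (cyclotomic n) ^ j * Y'" "evals n Y' g" unfolding cyc_ord_def by blast
  thus ?thesis unfolding cyc_ord_def
    by - (rule exI[of _ "X' * Y'"], rule exI[of _ "\<lambda>z. f z * g z"], rule conjI, simp add: power_add, rule evals_mult)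
qed

lemma cyc_ord_mono:
  assumes "cyc_ord n i X" "j \<le> i" shows "cyc_ord n j X"
proof -
  from assms obtain X' f where X: "X = to_fract (cyclotomic n) ^ i * X'" "evals n X' f"
    unfolding cyc_ord_def by blast
  have "to_fract (cyclotomic n) ^ i = to_fract (cyclotomic n) ^ j * to_fract (cyclotomic n) ^ (i - j)"
    using assms(2) by (simp flip: power_add)
  hence "X = to_fract (cyclotomic n) ^ j * (to_fract (cyclotomic n) ^ (i - j) * X')"
    using X(1) by (simp add: mult.assoc)
  moreover have "evals n (to_fract (cyclotomic n) ^ (i - j) * X') (\<lambda>z. cpoly (cyclotomic n) z ^ (i - j) * f z)"
    by (intro evals_mult evals_power evals_poly X(2))
  ultimately show ?thesis unfolding cyc_ord_def by blast
qed

lemma cyc_ord_sum: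
  assumes "\<And>i. i \<in> I \<Longrightarrow> cyc_ord n j (X i)" shows "cyc_ord n j (\<Sum>i\<in>I. X i)"
  using assms by (induction I rule: infinite_finite_induct) (simp_all add: cyc_ord_0 cyc_ord_add)

lemma to_fract_power: "to_fract (p ^ j) = to_fract p ^ j"
  by (induction j) simp_all

lemma qcongI:
  assumes n: "n > 0" and "cyc_ord n j (A - B)" shows "qcong A B (cyclotomic n ^ j)"
proof -
  from assms obtain Y f where "A - B = to_fract (cyclotomic n) ^ j * Y" "evals n Y f"
    unfolding cyc_ord_def by blast
  moreover from this obtain U V where
    "V \<noteq> 0" "Y = to_fract U / to_fract V" "\<forall>z\<in>primitive_roots n. cpoly V z \<noteq> 0 \<and> f z = cpoly U z / cpoly V z"
    unfolding evals_def by metis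
  ultimately show ?thesis unfolding qcong_def using coprime_cyclotomicI[OF n, of V j]
    by - (rule exI[of _ U], rule exI[of _ V], auto simp: to_fract_power)
qed

section \<open>The terminating Whipple sum\<close>

lemma qpoch_0 [simp]: "qpoch x b 0 = 1"
  by (simp add: qpoch_def)

lemma qpoch_Suc: "qpoch x b (Suc m) = qpoch x b m * (1 - x * b ^ m)"
  by (simp add: qpoch_def)

lemma qpoch_Suc_left: "qpoch x b (Suc m) = (1 - x) * qpoch (x * b) b m"
  unfolding qpoch_def prod.lessThan_Suc_shift by (simp add: mult.assoc)

lemma qpoch_eq_0_iff:
  fixes x :: "'a :: idom"
  shows "qpoch x b m = 0 \<longleftrightarrow> (\<exists>i<m. x * b ^ i = 1)"
  by (auto simp: qpoch_def)

lemma whipple_denominator_nonzero: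
  fixes Q :: "'a :: field"
  assumes "\<And>i. 0 < i \<Longrightarrow> i \<le> k \<Longrightarrow> Q ^ (2 * i) \<noteq> 1"
  shows "(qpoch Q Q k)^2 * qpoch (Q^2) (Q^2) k \<noteq> 0"
proof -
  have "Q ^ (2 * Suc i) = Q^2 * (Q^2) ^ i" "Q ^ (2 * Suc i) = (Q * Q ^ i)^2" for i
    by (simp_all only: power_mult[of Q 2] power_Suc[symmetric]) (simp only: power_mult[symmetric] mult.commute)
  hence "Q^2 * (Q^2) ^ i \<noteq> 1" "Q * Q ^ i \<noteq> 1" if "i < k" for i
    using that assms[of "Suc i"] by (metis Suc_leI zero_less_Suc, metis Suc_leI zero_less_Suc one_power2)
  thus ?thesis by (simp add: qpoch_eq_0_iff)
qed

text \<open>At \<open>Q = q^2\<close> this is \<open>cq k\<close> without (q;q^2)_k^2, the factor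
  that gets deformed.\<close>

definition whipple_weight :: "'a::field \<Rightarrow> nat \<Rightarrow> 'a" where
  "whipple_weight Q k = qpoch Q (Q^2) k / ((qpoch Q Q k)^2 * qpoch (Q^2) (Q^2) k) * Q ^ k"

text \<open>A balanced 4phi3 series in base \<open>Q\<close>, with upper parameters A, Q/A, sqrt Q,
  -sqrt Q and lower parameters Q, Q, -Q, cut off after \<open>k = M\<close>.\<close>

definition whipple_sum :: "'a::field \<Rightarrow> 'a \<Rightarrow> nat \<Rightarrow> 'a" where
  "whipple_sum Q A M = (\<Sum>k\<le>M. qpoch A Q k * qpoch (Q / A) Q k * whipple_weight Q k)"

text \<open>The summation is Andrews' terminating q-analogue of Whipple's sum, proved by creative
  telescoping in the step \<open>A \<mapsto> A Q\<^sup>2\<close>; with \<open>K = Q ^ k\<close>, the rational certificate is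
  \<open>- A Q (1 - A\<^sup>2 Q) (1 - K)\<^sup>2 (1 - K\<^sup>2) / (K (A Q - K) (A - K))\<close>. The identity below is its
  defining equation after cancelling the common q-shifted factorials.\<close>

lemma whipple_certificate:
  fixes A Q K :: "'a :: field"
  assumes "A \<noteq> 0" "Q \<noteq> 0"
  shows "- (1 - A^2*Q) / A * (1-A) * (1-A*Q) * ((1-A*K) * (1 - K/(Q*A)) * (1 - Q*K^2) - (1-K)^2*(1-K^2)) =
    K * ((1-A*Q)^2 * ((1-A*K) * (1-A*Q*K) * (1 - 1/(A*Q)) * (1 - 1/A))
       - Q * (1-A)^2 * ((1-A) * (1-A*Q) * (1 - K/(Q*A)) * (1 - K/A)))"
proof -
  have 1: "1 - K/(Q*A) = (Q*A-K)/(Q*A)" "1 - K/A = (A-K)/A" "1 - 1/(A*Q) = (A*Q-1)/(A*Q)" "1 - 1/A = (A-1)/A"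
    using assms by (simp_all add: field_simps)
  show ?thesis unfolding 1 using assms by (simp add: divide_simps) algebra
qed

text \<open>Let G(k) be the certificate times the summand of \<open>whipple_sum Q A\<close>. The
  summands on the left combine to G(k+1) - G(k), and G(0) = 0 through the factor 1 - K, so only the
  upper boundary term survives. Its factor (Q/A;Q)_(k-1) is why the truncation starts at 1.\<close>

lemma whipple_sum_telescoped:
  fixes A Q :: "'a :: field"
  assumes A: "A \<noteq> 0" and Q: "Q \<noteq> 0" and nz: "\<And>i. 0 < i \<Longrightarrow> i \<le> 2 * Suc m \<Longrightarrow> Q ^ i \<noteq> 1"
  shows "(1 - A*Q)^2 * whipple_sum Q (A*Q^2) (Suc m) - Q * (1-A)^2 * whipple_sum Q A (Suc m) =
    - (1 - A^2*Q) / A * qpoch A Q (m+2) * qpoch (Q/A) Q m * qpoch Q (Q^2) (m+2) /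
      ((qpoch Q Q (Suc m))^2 * qpoch (Q^2) (Q^2) (Suc m))"
  using nz
proof (induction m)
  case 0
  have "Q \<noteq> 1" "Q^2 \<noteq> 1" using 0[of 1] 0[of 2] by auto
  hence nz: "1 - Q \<noteq> 0" "1 - Q^2 \<noteq> 0" by auto
  have 1: "1 - Q / (A * Q^2) = (A*Q-1)/(A*Q)" "1 - Q/A = (A-Q)/A"
    using A Q by (simp_all add: field_simps power2_eq_square)
  have w: "whipple_weight Q 1 = Q / ((1-Q) * (1-Q^2))"
    using nz by (simp add: whipple_weight_def qpoch_Suc power2_eq_square)
  have s: "whipple_sum Q B 1 = 1 + (1 - B) * (1 - Q/B) * (Q / ((1-Q) * (1-Q^2)))" for B
    unfolding w[symmetric] by (simp add: whipple_sum_def qpoch_Suc whipple_weight_def)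
  have r: "qpoch A Q (Suc (Suc 0)) = (1-A)*(1-A*Q)" "qpoch Q (Q^2) (Suc (Suc 0)) = (1-Q)*(1-Q^3)"
     "qpoch A Q 2 = (1-A)*(1-A*Q)" "qpoch Q (Q^2) 2 = (1-Q)*(1-Q^3)"
     "qpoch Q Q 1 = 1 - Q" "qpoch (Q^2) (Q^2) 1 = 1 - Q^2"
    by (simp_all add: numeral_2_eq_2 numeral_3_eq_3 qpoch_Suc)
  have "(1 - A*Q)^2 * (1 + (1 - A*Q^2) * ((A*Q-1)/(A*Q)) * (Q / ((1-Q) * (1-Q^2))))
       - Q * (1-A)^2 * (1 + (1 - A) * ((A-Q)/A) * (Q / ((1-Q) * (1-Q^2)))) =
    - (1 - A^2*Q) / A * ((1-A)*(1-A*Q)) * ((1-Q)*(1-Q^3)) / ((1-Q)^2 * (1-Q^2))"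
    using nz A Q apply (simp add: divide_simps del: right_minus_eq eq_iff_diff_eq_0) by algebra
  thus ?case using s[of A] s[of "A*Q^2"] r 1 by simp
next
  case (Suc m)
  define K where "K = Q ^ (m+2)"
  \<comment> \<open>\<open>\<alpha>\<close> and \<open>\<beta>\<close> are the shifted factorials
    common to the parameters \<open>A\<close> and \<open>A*Q^2\<close>; what is left over are the
    factors in the certificate identity.\<close>
  define \<alpha> where "\<alpha> = qpoch (A*Q^2) Q m"
  define \<beta> where "\<beta> = qpoch (Q/A) Q m"
  define D where "D = (qpoch Q Q (Suc m))^2 * qpoch (Q^2) (Q^2) (Suc m)"
  define P where "P = qpoch Q (Q^2) (m+2)"
  have "K \<noteq> 1" "K^2 \<noteq> 1" using Suc.prems[of "m+2"] Suc.prems[of "2*(m+2)"] unfolding K_def power_mult[symmetric] by (auto simp: mult.commute)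
  hence K: "1 - K \<noteq> 0" "1 - K^2 \<noteq> 0" by auto
  have a: "qpoch A Q (m+2) = (1-A)*(1-A*Q)*\<alpha>"
    unfolding \<alpha>_def by (simp add: qpoch_Suc_left power2_eq_square mult.assoc)
  have a3: "qpoch A Q (m+3) = (1-A)*(1-A*Q)*\<alpha>*(1-A*K)"
    using a qpoch_Suc[of A Q "m+2"] unfolding K_def by (simp add: numeral_3_eq_3)
  have a': "qpoch (A*Q^2) Q (m+2) = \<alpha>*(1-A*K)*(1-A*Q*K)"
    unfolding \<alpha>_def K_def by (simp add: qpoch_Suc power_add power2_eq_square mult_ac)
  have b1: "qpoch (Q/A) Q (Suc m) = \<beta>*(1-K/(Q*A))"
    unfolding \<beta>_def K_def using Q by (simp add: qpoch_Suc power2_eq_square)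
  have b2: "qpoch (Q/A) Q (m+2) = \<beta>*(1-K/(Q*A))*(1-K/A)"
    using b1 qpoch_Suc[of "Q/A" Q "Suc m"] unfolding K_def by simp
  have b': "qpoch (Q/(A*Q^2)) Q (m+2) = (1-1/(A*Q))*(1-1/A)*\<beta>"
  proof -
    have "Q/(A*Q^2) = 1/(A*Q)" "1/(A*Q)*Q = 1/A" "1/A*Q = Q/A" using Q by (simp_all add: power2_eq_square)
    thus ?thesis unfolding \<beta>_def add_2_eq_Suc' qpoch_Suc_left by simp
  qed
  have w: "whipple_weight Q (m+2) = P / (D * ((1-K)^2 * (1-K^2))) * K"
  proof -
    have "(qpoch Q Q (m+2))^2 * qpoch (Q^2) (Q^2) (m+2) = D * ((1-K)^2 * (1-K^2))"
      unfolding D_def K_def by (simp add: qpoch_Suc power_mult_distrib mult_ac power_add flip: power_mult)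
    thus ?thesis unfolding whipple_weight_def P_def K_def by simp
  qed
  have p: "qpoch Q (Q^2) (m+3) = P * (1 - Q*K^2)"
  proof -
    have "m + 3 = Suc (m + 2)" "(Q^2) ^ (m+2) = K^2" unfolding K_def
      by (simp, simp only: power_mult[symmetric] mult.commute)
    thus ?thesis unfolding P_def by (simp only: qpoch_Suc)
  qed
  have d: "(qpoch Q Q (m+2))^2 * qpoch (Q^2) (Q^2) (m+2) = D * ((1-K)^2 * (1-K^2))"
    unfolding D_def K_def by (simp add: qpoch_Suc power_mult_distrib mult_ac power_add flip: power_mult)
  have S: "whipple_sum Q B (Suc (Suc m)) = whipple_sum Q B (Suc m) + qpoch B Q (m+2) * qpoch (Q/B) Q (m+2) * whipple_weight Q (m+2)" for B
    by (simp add: whipple_sum_def)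
  \<comment> \<open>Up to the common factor \<open>\<alpha> * \<beta> * P / D\<close>, the induction
    hypothesis contributes \<open>?C\<close> and the new summand \<open>K * ?Z / ?Y\<close>; the
    certificate makes their sum \<open>?C * ?X / ?Y\<close>.\<close>
  let ?X = "(1-A*K) * (1 - K/(Q*A)) * (1 - Q*K^2)" and ?Y = "(1-K)^2*(1-K^2)"
  let ?C = "- (1 - A^2*Q) / A * (1-A) * (1-A*Q)"
  let ?Z = "(1-A*Q)^2 * ((1-A*K) * (1-A*Q*K) * (1 - 1/(A*Q)) * (1 - 1/A))
       - Q * (1-A)^2 * ((1-A) * (1-A*Q) * (1 - K/(Q*A)) * (1 - K/A))"
  have g1: "c / A * (u * v * \<alpha>) * \<beta> * P / D = \<alpha> * \<beta> * P / D * (c / A * u * v)" for c u v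
    by (simp add: mult_ac)
  have g2: "(c1 * (\<alpha>*x1*x2*(x3*x4*\<beta>)) - c2 * ((z1*z2*\<alpha>)*(\<beta>*z3*z4))) * (P / (D * y) * K) =
      \<alpha> * \<beta> * P / D * (K * (c1 * (x1*x2*x3*x4) - c2 * (z1*z2*z3*z4)) / y)"
    for c1 c2 x1 x2 x3 x4 z1 z2 z3 z4 y
    by (simp add: algebra_simps diff_divide_distrib)
  have g3: "c + c * (x - y) / y = c * x / y" if "y \<noteq> 0" for c x y :: 'a
    using that by (simp add: field_simps)
  have IH: "(1 - A*Q)^2 * whipple_sum Q (A*Q^2) (Suc m) - Q * (1-A)^2 * whipple_sum Q A (Suc m) =
     - (1 - A^2*Q) / A * ((1-A)*(1-A*Q)*\<alpha>) * \<beta> * P / D"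
    using Suc.IH Suc.prems unfolding a P_def[symmetric] D_def[symmetric] \<beta>_def[symmetric] by auto
  have "(1 - A*Q)^2 * whipple_sum Q (A*Q^2) (Suc (Suc m)) - Q * (1-A)^2 * whipple_sum Q A (Suc (Suc m)) =
     - (1 - A^2*Q) / A * ((1-A)*(1-A*Q)*\<alpha>) * \<beta> * P / D
      + ((1-A*Q)^2 * (\<alpha>*(1-A*K)*(1-A*Q*K)*((1-1/(A*Q))*(1-1/A)*\<beta>))
       - Q * (1-A)^2 * (((1-A)*(1-A*Q)*\<alpha>) * (\<beta>*(1-K/(Q*A))*(1-K/A)))) * (P / (D * ?Y) * K)"
    unfolding S a' b' a b2 w IH[symmetric] by (simp only: algebra_simps)
  also have "\<dots> = \<alpha> * \<beta> * P / D * (?C + K * ?Z / ?Y)"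
    unfolding g1 g2 distrib_left ..
  also have "K * ?Z = ?C * (?X - ?Y)"
    by (rule whipple_certificate[OF A Q, symmetric])
  also have "?C + ?C * (?X - ?Y) / ?Y = ?C * ?X / ?Y"
    using K by (intro g3) auto
  also have "\<alpha> * \<beta> * P / D * (?C * ?X / ?Y) = - (1 - A^2*Q) / A * ((1-A)*(1-A*Q)*\<alpha>*(1-A*K)) * (\<beta>*(1-K/(Q*A))) * (P * (1 - Q*K^2)) / (D * ?Y)"
    by (simp add: mult_ac)
  finally show ?case using a3 b1 p d by (simp add: numeral_3_eq_3)
qed

text \<open>Either alternative of \<open>bd\<close> kills the boundary term: the first when
  \<open>A\<close> is a suitable power of \<open>Q\<close>, the second at a root of unity and then
  for every \<open>A\<close>.\<close>

lemma whipple_sum_recurrence: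
  fixes A Q :: "'a :: field"
  assumes A: "A \<noteq> 0" and Q: "Q \<noteq> 0" and nz: "\<And>i. 0 < i \<Longrightarrow> i \<le> 2 * M \<Longrightarrow> Q ^ i \<noteq> 1" and M: "M > 0"
    and bd: "qpoch (Q/A) Q (M - 1) = 0 \<or> qpoch Q (Q^2) (M + 1) = 0"
  shows "(1 - A*Q)^2 * whipple_sum Q (A*Q^2) M = Q * (1-A)^2 * whipple_sum Q A M"
proof -
  obtain m where m: "M = Suc m" using M gr0_implies_Suc by blast
  show ?thesis using whipple_sum_telescoped[OF A Q, of m] nz bd unfolding m by auto
qed

text \<open>The recurrence is iterated from \<open>A = Q\<close>, where Q/A = 1 leaves only the
  summand for k = 0.\<close>

lemma whipple_sum_even:
  fixes Q :: "'a :: field"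
  assumes Q: "Q \<noteq> 0" and nz: "\<And>i. 0 < i \<Longrightarrow> i \<le> 2 * M \<Longrightarrow> Q ^ i \<noteq> 1" and "2 * j \<le> M"
  shows "whipple_sum Q (Q ^ (2*j+1)) M = (qpoch Q (Q^2) j / qpoch (Q^2) (Q^2) j)^2 * Q ^ j"
  using assms(3)
proof (induction j)
  case 0
  have "qpoch (Q/Q) Q k = 0" if "k > 0" for k
    using that Q by (auto simp: qpoch_eq_0_iff)
  hence "whipple_sum Q Q M = (\<Sum>k\<le>M. if k = 0 then 1 else 0)"
    unfolding whipple_sum_def by (intro sum.cong) (auto simp: whipple_weight_def)
  thus ?case by simp
next
  case (Suc j)
  \<comment> \<open>The factor of index \<open>2*j\<close> vanishes, and
    \<open>2 * Suc j \<le> M\<close> puts this index below \<open>M - 1\<close>.\<close>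
  have "Q / Q ^ (2*j+1) * Q ^ (2*j) = 1" using Q by simp
  hence bd: "qpoch (Q / Q ^ (2*j+1)) Q (M - 1) = 0"
    using Suc.prems unfolding qpoch_eq_0_iff by (intro exI[of _ "2*j"]) auto
  have "(1 - Q ^ (2*j+1) * Q)^2 * whipple_sum Q (Q ^ (2*j+1) * Q^2) M = Q * (1 - Q ^ (2*j+1))^2 * whipple_sum Q (Q ^ (2*j+1)) M"
    using Suc.prems Q nz bd by (intro whipple_sum_recurrence) auto
  moreover have "Q ^ (2*j+1) * Q^2 = Q ^ (2 * Suc j + 1)" by (simp add: power2_eq_square)
  moreover have "Q ^ (2*j+1) * Q = Q^2 * (Q^2) ^ j"
    using power_mult[of Q 2 "Suc j"] by (simp add: mult.commute)
  moreover have "Q ^ (2*j+1) = Q * (Q^2) ^ j" by (simp add: power_mult)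
  ultimately have rec: "(1 - Q^2 * (Q^2) ^ j)^2 * whipple_sum Q (Q ^ (2 * Suc j + 1)) M = Q * (1 - Q * (Q^2) ^ j)^2 * whipple_sum Q (Q ^ (2*j+1)) M"
    by metis
  have "Q^2 * (Q^2) ^ j \<noteq> 1" using nz[of "2 * Suc j", unfolded power_mult[of Q 2 "Suc j"]] Suc.prems by simp
  hence ne: "1 - Q^2 * (Q^2) ^ j \<noteq> 0" by simp
  have "whipple_sum Q (Q ^ (2 * Suc j + 1)) M = Q * (1 - Q * (Q^2) ^ j)^2 * whipple_sum Q (Q ^ (2*j+1)) M / (1 - Q^2 * (Q^2) ^ j)^2"
    using rec ne by (simp add: nonzero_eq_divide_eq mult.commute)
  also have "whipple_sum Q (Q ^ (2*j+1)) M = (qpoch Q (Q^2) j / qpoch (Q^2) (Q^2) j)^2 * Q ^ j"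
    using Suc by simp
  finally show ?case by (simp add: qpoch_Suc power_divide power_mult_distrib mult_ac)
qed

text \<open>The recurrence now starts from \<open>A = Q^2\<close>, where Q/A = 1/Q leaves the
  summands for k = 0 and k = 1, and these cancel.\<close>

lemma whipple_sum_odd:
  fixes Q :: "'a :: field"
  assumes Q: "Q \<noteq> 0" and nz: "\<And>i. 0 < i \<Longrightarrow> i \<le> 2 * M \<Longrightarrow> Q ^ i \<noteq> 1" and "2 * j + 1 \<le> M"
  shows "whipple_sum Q (Q ^ (2*j+2)) M = 0"
  using assms(3)
proof (induction j)
  case 0
  have van: "qpoch (Q/Q^2) Q k = 0" if "k > 1" for k
    using that Q unfolding qpoch_eq_0_iff by (intro exI[of _ 1]) (auto simp: power2_eq_square)
  have "Q \<noteq> 1" "Q^2 \<noteq> 1" using nz[of 1] nz[of 2] 0 by auto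
  hence nz: "1 - Q \<noteq> 0" "1 - Q^2 \<noteq> 0" by auto
  have "whipple_sum Q (Q^2) M = (\<Sum>k\<in>{0,1}. qpoch (Q^2) Q k * qpoch (Q / Q^2) Q k * whipple_weight Q k)"
    unfolding whipple_sum_def using van 0 by (intro sum.mono_neutral_right) auto
  also have "\<dots> = 1 + (1 - Q^2) * (1 - Q/Q^2) * ((1-Q) / ((1-Q)^2 * (1-Q^2)) * Q)"
    by (simp add: qpoch_Suc whipple_weight_def)
  also have "1 - Q/Q^2 = (Q - 1) / Q" using Q by (simp add: field_simps power2_eq_square)
  also have "1 + (1 - Q^2) * ((Q - 1) / Q) * ((1-Q) / ((1-Q)^2 * (1-Q^2)) * Q) = 0"
    using nz Q by (simp add: divide_simps power2_eq_square del: right_minus_eq)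
  finally show ?case by (simp add: power2_eq_square)
next
  case (Suc j)
  have "Q / Q ^ (2*j+2) * Q ^ (2*j+1) = 1" using Q by simp
  hence bd: "qpoch (Q / Q ^ (2*j+2)) Q (M - 1) = 0"
    using Suc.prems unfolding qpoch_eq_0_iff by (intro exI[of _ "2*j+1"]) auto
  have "(1 - Q ^ (2*j+2) * Q)^2 * whipple_sum Q (Q ^ (2*j+2) * Q^2) M = Q * (1 - Q ^ (2*j+2))^2 * whipple_sum Q (Q ^ (2*j+2)) M"
    using Suc.prems Q nz bd by (intro whipple_sum_recurrence) auto
  moreover have "Q ^ (2*j+2) * Q^2 = Q ^ (2 * Suc j + 2)" "Q ^ (2*j+2) * Q = Q ^ (2*j+3)"
    by (simp_all add: power2_eq_square power3_eq_cube power_add)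
  ultimately have "(1 - Q ^ (2*j+3))^2 * whipple_sum Q (Q ^ (2 * Suc j + 2)) M = Q * (1 - Q ^ (2*j+2))^2 * whipple_sum Q (Q ^ (2*j+2)) M"
    by metis
  moreover have "whipple_sum Q (Q ^ (2*j+2)) M = 0" "Q ^ (2*j+3) \<noteq> 1"
    using Suc nz[of "2*j+3"] by auto
  ultimately show ?case by simp
qed

section \<open>The deformed sum as a polynomial\<close>

text \<open>The variable of this polynomial stands for \<open>a + 1/a - 2 = (1 - a)\<^sup>2 / a\<close>, with \<open>a = 1\<close> giving
  the partial sums of \<open>cq\<close>.\<close>

definition whipple_poly :: "'a::field \<Rightarrow> nat \<Rightarrow> 'a poly" where
  "whipple_poly x M = (\<Sum>k\<le>M. smult (whipple_weight (x^2) k) (\<Prod>i<k. [:(1 - x ^ (2*i+1))^2, - (x ^ (2*i+1)):]))"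

text \<open>The product (1 - a y)(1 - y/a) is invariant under a -> 1/a, and equals (1 - y)^2 - y u
  with u = (1 - a)^2/a.\<close>

lemma poly_whipple_poly:
  fixes x a :: "'a :: field"
  assumes "x \<noteq> 0" "a \<noteq> 0"
  shows "poly (whipple_poly x M) ((1 - a)^2 / a) = whipple_sum (x^2) (a * x) M"
proof -
  have 1: "poly [:(1 - y)^2, - y:] ((1 - a)^2 / a) = (1 - a * y) * (1 - y / a)" for y
    using assms by (simp add: field_simps power2_eq_square)
  have 2: "(\<Prod>i<k. (1 - a * x ^ (2*i+1)) * (1 - x ^ (2*i+1) / a)) = qpoch (a * x) (x^2) k * qpoch (x^2 / (a * x)) (x^2) k" for k
    unfolding qpoch_def prod.distrib[symmetric]
    using assms by (intro prod.cong) (simp_all add: power2_eq_square power_mult mult.assoc)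
  show ?thesis unfolding whipple_poly_def whipple_sum_def
    by (simp only: poly_sum poly_smult poly_prod 1 2 mult.commute[of "whipple_weight _ _"])
qed

lemma degree_whipple_poly: "degree (whipple_poly x M) \<le> M"
  unfolding whipple_poly_def
proof (intro degree_sum_le)
  fix k assume "k \<in> {..M}"
  have "degree (\<Prod>i<k. [:(1 - x ^ (2*i+1))^2, - (x ^ (2*i+1)):]) \<le> (\<Sum>i<k. 1)"
    by (rule order_trans[OF degree_prod_sum_le]) (simp, unfold o_def, intro sum_mono, simp)
  with \<open>k \<in> {..M}\<close> show "degree (smult (whipple_weight (x^2) k) (\<Prod>i<k. [:(1 - x ^ (2*i+1))^2, - (x ^ (2*i+1)):])) \<le> M"
    by (intro order_trans[OF degree_smult_le]) simp
qed simp

lemma coeff_0_whipple_poly: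
  "coeff (whipple_poly x M) 0 = (\<Sum>k\<le>M. (qpoch x (x^2) k)^2 * whipple_weight (x^2) k)"
proof -
  have 1: "poly [:(1 - y)^2, - y:] 0 = (1 - y)^2" for y :: 'a by simp
  have 2: "(\<Prod>i<k. (1 - x ^ (2*i+1))^2) = (qpoch x (x^2) k)^2" for k
    unfolding qpoch_def by (simp add: prod_power_distrib power_mult)
  show ?thesis unfolding whipple_poly_def poly_0_coeff_0[symmetric]
    by (simp only: poly_sum poly_smult poly_prod 1 2 mult.commute[of "whipple_weight _ _"])
qed

section \<open>The deformed sum at a root of unity\<close>

lemma double_root_dvd:
  fixes p :: "'a::{idom_divide,field_char_0} poly"
  assumes "poly p c = 0" "poly (pderiv p) c = 0"
  shows "[:- c, 1:] ^ 2 dvd p"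
proof -
  from assms(1) obtain r where r: "p = [:- c, 1:] * r" by (auto simp: poly_eq_0_iff_dvd elim: dvdE)
  hence "poly r c = 0" using assms(2) by (simp add: pderiv_mult pderiv_pCons del: mult_pCons_left)
  hence "[:- c, 1:] dvd r" by (simp only: poly_eq_0_iff_dvd)
  thus ?thesis unfolding r power2_eq_square by (rule mult_dvd_mono[OF dvd_refl])
qed

text \<open>This is the logarithmic derivative at 0: each squared factor contributes -2/u.\<close>

lemma coeff_prod_squares:
  fixes u :: "'b \<Rightarrow> 'a::field"
  assumes "finite S" "\<And>s. s \<in> S \<Longrightarrow> u s \<noteq> 0"
  shows "coeff (\<Prod>s\<in>S. [:- u s, 1:] ^ 2) 1 = - 2 * (\<Sum>s\<in>S. 1 / u s) * coeff (\<Prod>s\<in>S. [:- u s, 1:] ^ 2) 0"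
  using assms
proof (induction S rule: finite_induct)
  case (insert x S)
  have 1: "coeff (p * r) 1 = coeff p 0 * coeff r 1 + coeff p 1 * coeff r 0" for p r :: "'a poly"
    by (simp add: coeff_mult)
  have 2: "coeff ([:- u x, 1:] ^ 2) 0 = u x ^ 2" "coeff ([:- u x, 1:] ^ 2) 1 = - 2 * u x"
    by (simp_all add: power2_eq_square)
  have ux: "u x \<noteq> 0" using insert.prems by simp
  have IH: "coeff (\<Prod>s\<in>S. [:- u s, 1:] ^ 2) 1 = - 2 * (\<Sum>s\<in>S. 1 / u s) * coeff (\<Prod>s\<in>S. [:- u s, 1:] ^ 2) 0"
    using insert by simp
  have 3: "(\<Prod>s\<in>insert x S. [:- u s, 1:] ^ 2) = [:- u x, 1:] ^ 2 * (\<Prod>s\<in>S. [:- u s, 1:] ^ 2)"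
    "(\<Sum>s\<in>insert x S. 1 / u s) = 1 / u x + (\<Sum>s\<in>S. 1 / u s)"
    using insert.hyps by simp_all
  define c where "c = coeff (\<Prod>s\<in>S. [:- u s, 1:] ^ 2) 0"
  have "u x ^ 2 * (- 2 * t * c) + - 2 * u x * c = - 2 * (1 / u x + t) * (u x ^ 2 * c)" for t
    using ux by (simp add: algebra_simps power2_eq_square)
  thus ?case unfolding 3 1 2 coeff_mult_0 IH c_def[symmetric] by simp
qed simp

text \<open>At a root of unity the boundary term of the telescoped recurrence vanishes identically in
  \<open>a\<close>, so the recurrence and its derivative carry a double zero from \<open>a = b z\<^sup>4\<close> to \<open>a = b\<close>; the
  factor \<open>(1 - a z\<^sup>3)\<^sup>2\<close> creates the first one.\<close>

lemma whipple_poly_double_root_step: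
  fixes z b :: complex and M :: nat
  defines "u \<equiv> \<lambda>a. (1 - a)^2 / a" and "P \<equiv> whipple_poly z M"
  assumes z: "z \<noteq> 0" and b: "b \<noteq> 0" "b^2 \<noteq> 1" "b * z \<noteq> 1"
    and M: "M > 0" and nz: "\<And>i. 0 < i \<Longrightarrow> i \<le> 2 * M \<Longrightarrow> (z^2) ^ i \<noteq> 1" and bd: "qpoch (z^2) (z^4) (M + 1) = 0"
    and prev: "b * z^3 = 1 \<or> poly P (u (b * z^4)) = 0 \<and> poly (pderiv P) (u (b * z^4)) = 0"
  shows "poly P (u b) = 0 \<and> poly (pderiv P) (u b) = 0"
proof -
  \<comment> \<open>The recurrence is taken at \<open>Q = z^2\<close> and \<open>A = a * z\<close>;
    the hypothesis \<open>bd\<close> makes it valid for all nonzero \<open>a\<close>.\<close>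
  have rec: "(1 - a * z^3)^2 * poly P (u (a * z^4)) = z^2 * (1 - a * z)^2 * poly P (u a)" if "a \<noteq> 0" for a
  proof -
    have "(1 - (a * z) * z^2)^2 * whipple_sum (z^2) ((a * z) * (z^2)^2) M = z^2 * (1 - a * z)^2 * whipple_sum (z^2) (a * z) M"
      using that z M nz bd by (intro whipple_sum_recurrence) auto
    moreover have "(a * z) * z^2 = a * z^3" "(a * z) * (z^2)^2 = a * z^4 * z" "(a * z) * z^4 = a * z^4 * z"
      by (simp_all add: power2_eq_square power3_eq_cube power4_eq_xxxx del: power_mult_numeral)
    ultimately show ?thesis using that z by (simp add: poly_whipple_poly u_def P_def)
  qed
  have du: "((\<lambda>a. poly P (u a)) has_field_derivative poly (pderiv P) (u b) * (1 - 1 / b^2)) (at b)"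
    unfolding u_def using b(1)
    by (auto intro!: derivative_eq_intros simp: power2_eq_square field_simps)
  have du': "((\<lambda>a. poly P (u (a * z^4))) has_field_derivative poly (pderiv P) (u (b * z^4)) * ((1 - 1 / (b * z^4)^2) * z^4)) (at b)"
    unfolding u_def using b(1) z
    by (auto intro!: derivative_eq_intros simp: power2_eq_square field_simps)
  define L where "L = (\<lambda>a. (1 - a * z^3)^2 * poly P (u (a * z^4)))"
  define R where "R = (\<lambda>a. z^2 * (1 - a * z)^2 * poly P (u a))"
  \<comment> \<open>Both sides agree on a neighbourhood of \<open>b\<close>, so their derivatives at
    \<open>b\<close> agree as well.\<close>
  have ev: "eventually (\<lambda>a. L a = R a) (nhds b)"
    using eventually_nhds_in_open[of "- {0}" b] b(1)
    by (auto elim!: eventually_mono simp: L_def R_def rec open_Compl)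
  have "(L has_field_derivative (1 - b * z^3)^2 * (poly (pderiv P) (u (b * z^4)) * ((1 - 1 / (b * z^4)^2) * z^4))
      + 2 * (1 - b * z^3) * (- (z^3)) * poly P (u (b * z^4))) (at b)"
    unfolding L_def by (rule derivative_eq_intros du' refl | simp)+
  moreover have "(1 - b * z^3)^2 * (poly (pderiv P) (u (b * z^4)) * ((1 - 1 / (b * z^4)^2) * z^4))
      + 2 * (1 - b * z^3) * (- (z^3)) * poly P (u (b * z^4)) = 0"
    using prev by auto
  ultimately have "(L has_field_derivative 0) (at b)" by simp
  hence R0: "(R has_field_derivative 0) (at b)"
    using DERIV_cong_ev[OF refl ev refl] by simp
  have "(R has_field_derivative z^2 * (1 - b * z)^2 * (poly (pderiv P) (u b) * (1 - 1 / b^2))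
      + z^2 * (2 * (1 - b * z) * (- z)) * poly P (u b)) (at b)"
    unfolding R_def by (rule derivative_eq_intros du refl | simp)+
  from DERIV_unique[OF this R0]
  have 1: "z^2 * (1 - b * z)^2 * (poly (pderiv P) (u b) * (1 - 1 / b^2))
      + z^2 * (2 * (1 - b * z) * (- z)) * poly P (u b) = 0" .
  have "L b = 0" using prev by (auto simp: L_def)
  hence "R b = 0" using rec[OF b(1)] by (simp add: L_def R_def)
  hence 2: "poly P (u b) = 0" using z b by (simp add: R_def)
  \<comment> \<open>This is the derivative of \<open>u\<close> at \<open>b\<close>; being nonzero,
    it lets the zero derivative in \<open>a\<close> pass to \<open>pderiv P\<close>.\<close>
  moreover have "1 - 1 / b^2 \<noteq> 0" using b by (simp add: field_simps)
  ultimately show ?thesis using 1 z b by simp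
qed

text \<open>The double zeros at the \<open>r\<close> distinct values u(a), a = z^(4k-2), exhaust the
  degree bound 2r. Hence the polynomial is a constant times a product of squares, and 1/u(a) = a/(1
  - a)^2 gives the sum.\<close>

lemma coeff_1_whipple_poly_root_of_unity:
  fixes z :: complex
  assumes z: "z \<in> primitive_roots (4 * r + 1)"
  shows "coeff (whipple_poly z (2 * r)) 1 =
     - 2 * (\<Sum>k=1..r. z ^ (4*k-2) / (1 - z ^ (4*k-2))^2) * coeff (whipple_poly z (2 * r)) 0"
proof (cases "r = 0")
  case True thus ?thesis by (simp add: whipple_poly_def)
next
  case False
  define n where "n = 4 * r + 1"
  define u :: "complex \<Rightarrow> complex" where "u = (\<lambda>a. (1 - a)^2 / a)"
  define P where "P = whipple_poly z (2 * r)"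
  have pow: "z ^ i = 1 \<longleftrightarrow> n dvd i" for i
    using primitive_roots_power_eq_1_iff[OF z] by (simp add: n_def)
  have "z ^ n = 1" by (simp add: pow)
  hence z0: "z \<noteq> 0" by (auto simp: n_def)
  have odd: "coprime n 2" "coprime n 4" using coprime_power_right_iff[of n 2 2] by (auto simp: n_def)
  have nd: "z ^ i \<noteq> 1" if "0 < i" "i < n" for i using that unfolding pow by (auto dest: dvd_imp_le)
  have nd2: "z ^ (2 * i) \<noteq> 1" if "0 < i" "i < n" for i
    using nd[OF that] odd unfolding pow by (simp add: coprime_dvd_mult_right_iff)
  have nz: "(z^2) ^ i \<noteq> 1" if "0 < i" "i \<le> 2 * (2 * r)" for i
    using nd2[of i] that by (simp add: n_def power_mult)
  have bd: "qpoch (z^2) (z^4) (2 * r + 1) = 0"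
  proof -
    \<comment> \<open>The last factor of the shifted factorial is 1 - z^(2n).\<close>
    have "z^2 * (z^4) ^ (2*r) = z ^ (2 + 4 * (2*r))" by (simp only: power_mult power_add)
    also have "2 + 4 * (2*r) = n * 2" by (simp add: n_def)
    also have "z ^ (n * 2) = 1" by (simp add: pow)
    finally show ?thesis unfolding qpoch_eq_0_iff by (intro exI[of _ "2*r"]) simp
  qed
  have dr: "poly P (u (z ^ (4*k-2))) = 0 \<and> poly (pderiv P) (u (z ^ (4*k-2))) = 0" if "k \<le> r" "1 \<le> k" for k
    using that
  proof (induction k rule: inc_induct)
    case base
    \<comment> \<open>The descent starts at k = r, where the factor 1 - b z^3 supplies the first
      double zero.\<close>
    have "z ^ (4*r-2) * z^3 = z ^ n" unfolding power_add[symmetric]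
      using False by (intro arg_cong[of _ _ "(^) z"]) (auto simp: n_def)
    hence "z ^ (4*r-2) * z^3 = 1" using \<open>z ^ n = 1\<close> by simp
    moreover have "(z ^ (4*r-2))^2 \<noteq> 1"
      using nd2[of "4*r-2"] False unfolding power_mult[symmetric] mult.commute[of _ 2] by (simp add: n_def)
    moreover have "z ^ (4*r-2) * z \<noteq> 1"
    proof -
      have "z ^ (4*r-1) = z ^ (4*r-2) * z ^ 1" unfolding power_add[symmetric]
        using False by (intro arg_cong[of _ _ "(^) z"]) auto
      thus ?thesis using nd[of "4*r-1"] False by (simp add: n_def)
    qed
    ultimately show ?case unfolding P_def u_def
      using False z0 nz bd by (intro whipple_poly_double_root_step) auto
  next
    case (step k)
    have "z ^ (4*k-2) * z^4 = z ^ (4 * Suc k - 2)" unfolding power_add[symmetric]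
      using step by (intro arg_cong[of _ _ "(^) z"]) auto
    moreover have "(z ^ (4*k-2))^2 \<noteq> 1"
      using nd2[of "4*k-2"] step unfolding power_mult[symmetric] mult.commute[of _ 2] by (simp add: n_def)
    moreover have "z ^ (4*k-2) * z \<noteq> 1"
    proof -
      have "z ^ (4*k-1) = z ^ (4*k-2) * z ^ 1" unfolding power_add[symmetric]
        using step by (intro arg_cong[of _ _ "(^) z"]) auto
      thus ?thesis using nd[of "4*k-1"] step by (simp add: n_def)
    qed
    ultimately show ?case using step.IH unfolding P_def u_def
      using False z0 nz bd by (intro whipple_poly_double_root_step) auto
  qed
  have inj: "inj_on (\<lambda>k. u (z ^ (4*k-2))) {1..r}"
  proof (rule inj_onI)
    fix k l assume kl: "k \<in> {1..r}" "l \<in> {1..r}" and eq: "u (z ^ (4*k-2)) = u (z ^ (4*l-2))"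
    define a b where "a = z ^ (4*k-2)" and "b = z ^ (4*l-2)"
    have ab: "a \<noteq> 0" "b \<noteq> 0" using z0 by (auto simp: a_def b_def)
    have "(1 - a)^2 / a = (1 - b)^2 / b" using eq by (simp add: a_def b_def u_def)
    hence "(1 - a)^2 * b = (1 - b)^2 * a" using ab by (simp add: field_simps)
    \<comment> \<open>Equal values of \<open>u\<close> mean that \<open>a\<close> and
      \<open>b\<close> are equal or inverse; the exponent of a b is excluded as a multiple of the
      odd \<open>n\<close>.\<close>
    hence "(a - b) * (a * b - 1) = 0" by algebra
    moreover have "a * b \<noteq> 1"
    proof -
      have "a * b = z ^ (2 * (2 * k + 2 * l - 2))"
        unfolding a_def b_def power_add[symmetric] using kl by (intro arg_cong[of _ _ "(^) z"]) auto
      moreover have "0 < 2 * k + 2 * l - 2" "2 * k + 2 * l - 2 < n" using kl unfolding n_def atLeastAtMost_iff by linarith+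
      ultimately show ?thesis using nd2[of "2 * k + 2 * l - 2"] by simp
    qed
    ultimately have ab': "a = b" by simp
    show "k = l"
    proof (rule ccontr)
      have *: False if "i < j" "j \<in> {1..r}" "i \<in> {1..r}" "z ^ (4*i-2) = z ^ (4*j-2)" for i j
      proof -
        have "4*j-2 = (4*i-2) + (4*j-4*i)" using that by auto
        hence "z ^ (4*j-2) = z ^ (4*i-2) * z ^ (4*j-4*i)" by (simp only: power_add)
        hence "z ^ (4*j-4*i) = 1" using that z0 by simp
        moreover have "0 < 4*j-4*i" "4*j-4*i < n" using that unfolding n_def atLeastAtMost_iff by linarith+
        ultimately show False using nd[of "4*j-4*i"] by simp
      qed
      assume "k \<noteq> l"
      thus False using *[of k l] *[of l k] ab' kl by (auto simp: a_def b_def neq_iff)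
    qed
  qed
  define D where "D = (\<Prod>k\<in>{1..r}. [:- u (z ^ (4*k-2)), 1:] ^ 2)"
  have "D dvd P" unfolding D_def
    using dr inj by (intro prod_linear_power_dvd double_root_dvd) auto
  then obtain c where c: "P = D * c" by (elim dvdE)
  have "degree D = 2 * r"
    unfolding D_def by (subst degree_prod_eq_sum_degree) (auto simp: degree_power_eq)
  moreover have "degree P \<le> 2 * r" unfolding P_def by (rule degree_whipple_poly)
  moreover have "D \<noteq> 0" by (auto simp: D_def)
  ultimately have "degree c = 0" using c by (cases "c = 0") (simp_all add: degree_mult_eq)
  then obtain c0 where c0: "P = smult c0 D" using c by (auto elim: degree_eq_zeroE)
  have "coeff D 1 = - 2 * (\<Sum>k\<in>{1..r}. 1 / u (z ^ (4*k-2))) * coeff D 0"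
    unfolding D_def
  proof (rule coeff_prod_squares)
    fix k assume "k \<in> {1..r}"
    hence "0 < 4*k-2" "4*k-2 < n" unfolding n_def atLeastAtMost_iff by linarith+
    thus "u (z ^ (4*k-2)) \<noteq> 0" using nd[of "4*k-2"] z0 by (auto simp: u_def)
  qed simp
  thus ?thesis unfolding P_def[symmetric] c0 by (simp add: u_def)
qed

section \<open>The congruences\<close>

lemma q_power_eq_1_iff [simp]: "q ^ i = 1 \<longleftrightarrow> i = 0"
proof -
  have "degree ([:0, 1:] ^ i :: rat poly) = i" by (simp add: degree_power_eq)
  hence "[:0, 1:] ^ i = (1 :: rat poly) \<Longrightarrow> i = 0" by (metis degree_1)
  moreover have "q ^ i = 1 \<longleftrightarrow> to_fract ([:0, 1:] ^ i) = to_fract (1 :: rat poly)"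
    unfolding q_def by (simp add: to_fract_power)
  ultimately show ?thesis unfolding to_fract_eq_iff by auto
qed

lemma q_nonzero [simp]: "q \<noteq> 0"
  by (simp add: q_def)

lemma primitive_roots_nonzero: "z \<in> primitive_roots n \<Longrightarrow> n > 0 \<Longrightarrow> z \<noteq> 0"
  by (auto simp: primitive_roots_def power_0_left)

text \<open>An odd \<open>n\<close> is coprime to 4. The form with \<open>z^2\<close> matches
  \<open>whipple_denominator_nonzero\<close> at \<open>Q = z^2\<close>.\<close>

lemma primitive_root_power_even_neq_1:
  assumes "z \<in> primitive_roots n" "odd n" "0 < i" "i < n"
  shows "(z^2) ^ (2 * i) \<noteq> 1"
proof -
  have "coprime n 2" using assms(2) by simp
  hence "coprime n (2 * 2)" by (simp only: coprime_mult_right_iff)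
  moreover have "\<not> n dvd i" using assms(3,4) by (auto dest: dvd_imp_le)
  ultimately have "\<not> n dvd (2 * 2) * i" by (metis coprime_dvd_mult_right_iff)
  hence "z ^ ((2 * 2) * i) \<noteq> 1"
    using assms by (subst primitive_roots_power_eq_1_iff[OF assms(1)]) auto
  thus ?thesis by (simp flip: power_mult)
qed

section \<open>Regularity of the summands and reduction to a square\<close>

lemma evals_qpoch:
  assumes "evals n X f" "evals n B g" shows "evals n (qpoch X B k) (\<lambda>z. qpoch (f z) (g z) k)"
  unfolding qpoch_def by (intro evals_prod evals_diff evals_1 evals_mult evals_power assms)

lemma evals_whipple_denominator:
  assumes n: "n > 0" "odd n" and k: "k < n" and X: "evals n X f"
  shows "evals n (X / ((qpoch (q^2) (q^2) k)^2 * qpoch ((q^2)^2) ((q^2)^2) k))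
     (\<lambda>z. f z / ((qpoch (z^2) (z^2) k)^2 * qpoch ((z^2)^2) ((z^2)^2) k))"
proof (intro evals_mult evals_divide evals_qpoch evals_power evals_q n X)
  show "(qpoch (q^2) (q^2) k)^2 * qpoch ((q^2)^2) ((q^2)^2) k \<noteq> 0"
    by (rule whipple_denominator_nonzero) (simp flip: power_mult)
next
  fix z assume z: "z \<in> primitive_roots n"
  show "(qpoch (z^2) (z^2) k)^2 * qpoch ((z^2)^2) ((z^2)^2) k \<noteq> 0"
    using primitive_root_power_even_neq_1[OF z n(2)] k by (intro whipple_denominator_nonzero) auto
qed

lemma evals_whipple_weight:
  assumes "n > 0" "odd n" "k < n"
  shows "evals n (whipple_weight (q^2) k) (\<lambda>z. whipple_weight (z^2) k)"
  unfolding whipple_weight_def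
  by (intro evals_mult[OF evals_whipple_denominator] evals_qpoch evals_power evals_q assms)

lemma cq_eq: "cq k = (qpoch q (q^2) k)^2 * whipple_weight (q^2) k"
  by (simp add: cq_def whipple_weight_def flip: power_mult)

lemma evals_cq:
  assumes "n > 0" "odd n" "k < n"
  shows "evals n (cq k) (\<lambda>z. (qpoch z (z^2) k)^2 * whipple_weight (z^2) k)"
  unfolding cq_eq by (intro evals_mult evals_power evals_qpoch evals_q evals_whipple_weight assms)

text \<open>With n = 2m+1, the factors of index m are 1 - q^n in (q;q^2)_k, which occurs squared,
  and 1 - q^(2n) in (q^2;q^4)_k; the denominator is a unit for k < n.\<close>

lemma cyc_ord_cq_3:
  assumes n: "n > 0" "odd n" and k: "(n - 1) div 2 < k" "k < n"
  shows "cyc_ord n 3 (cq k)"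
proof -
  define m where "m = (n - 1) div 2"
  have m: "2 * m + 1 = n" using n by (auto simp: m_def elim!: oddE)
  have 1: "cyc_ord n 1 (qpoch q (q^2) k)"
  proof (rule cyc_ord_1I[OF n(1) evals_qpoch[OF evals_q evals_power[OF evals_q]]])
    fix z assume z: "z \<in> primitive_roots n"
    have "z * (z^2) ^ m = z ^ (2 * m + 1)" by (simp add: power_mult)
    also have "\<dots> = 1" using z unfolding m by (simp add: primitive_roots_def)
    finally show "qpoch z (z^2) k = 0" using k unfolding qpoch_eq_0_iff m_def by blast
  qed
  have "cyc_ord n 1 (qpoch (q^2) ((q^2)^2) k)"
  proof (rule cyc_ord_1I[OF n(1) evals_qpoch[OF evals_power[OF evals_q] evals_power[OF evals_power[OF evals_q]]]])
    fix z assume z: "z \<in> primitive_roots n"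
    have "z^2 * ((z^2)^2) ^ m = (z ^ (2 * m + 1))^2"
      by (simp add: power_mult power2_eq_square power_mult_distrib mult_ac)
    also have "\<dots> = 1" using z unfolding m by (simp add: primitive_roots_def)
    finally show "qpoch (z^2) ((z^2)^2) k = 0" using k unfolding qpoch_eq_0_iff m_def by blast
  qed
  from cyc_ord_mult[OF cyc_ord_mult[OF 1 1] this]
  have 3: "cyc_ord n 3 (qpoch q (q^2) k * qpoch q (q^2) k * qpoch (q^2) ((q^2)^2) k)"
    by (simp add: numeral_3_eq_3)
  have "evals n ((q^2) ^ k / ((qpoch (q^2) (q^2) k)^2 * qpoch ((q^2)^2) ((q^2)^2) k))
     (\<lambda>z. (z^2) ^ k / ((qpoch (z^2) (z^2) k)^2 * qpoch ((z^2)^2) ((z^2)^2) k))"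
    by (intro evals_whipple_denominator evals_power evals_q n k)
  from cyc_ord_mult[OF 3 cyc_ord_0I[OF this]] show ?thesis
    by (simp add: cq_eq whipple_weight_def power2_eq_square mult_ac)
qed

text \<open>The square of indices up to m lies inside the triangle because 2m = n - 1. Outside it
  one index exceeds m, and its \<open>cq\<close> has order 3.\<close>

lemma double_sum_cong:
  assumes n: "n > 0" "odd n"
  shows "cyc_ord n 3 ((\<Sum>k = 0..n - 1. \<Sum>j = 0..k. cq j * cq (k - j)) - (\<Sum>k\<le>(n - 1) div 2. cq k)^2)"
proof -
  define m where "m = (n - 1) div 2"
  have m: "2 * m + 1 = n" using n by (auto simp: m_def elim!: oddE)
  define T where "T = {(i, j). i + j \<le> n - 1}"
  define B where "B = {..m} \<times> {..m}"
  have B: "B \<subseteq> T" using m by (auto simp: B_def T_def)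
  have fin: "finite T" by (rule finite_subset[of _ "{..n} \<times> {..n}"]) (auto simp: T_def)
  have "(\<Sum>k = 0..n - 1. \<Sum>j = 0..k. cq j * cq (k - j)) = (\<Sum>(i,j)\<in>T. cq i * cq j)"
    unfolding T_def sum.triangle_reindex_eq atLeast0AtMost ..
  also have "\<dots> = (\<Sum>(i,j)\<in>T - B. cq i * cq j) + (\<Sum>(i,j)\<in>B. cq i * cq j)"
    by (rule sum.subset_diff[OF B fin])
  also have "(\<Sum>(i,j)\<in>B. cq i * cq j) = (\<Sum>k\<le>m. cq k)^2"
    unfolding B_def power2_eq_square sum_product sum.cartesian_product ..
  finally have "(\<Sum>k = 0..n - 1. \<Sum>j = 0..k. cq j * cq (k - j)) - (\<Sum>k\<le>m. cq k)^2 = (\<Sum>(i,j)\<in>T - B. cq i * cq j)"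
    by simp
  moreover have "cyc_ord n 3 (\<Sum>(i,j)\<in>T - B. cq i * cq j)"
  proof (rule cyc_ord_sum)
    fix p assume "p \<in> T - B"
    then obtain i j where p: "p = (i, j)" "i < n" "j < n" "m < i \<or> m < j"
      using m by (cases p) (auto simp: T_def B_def)
    have 0: "cyc_ord n 0 (cq i)" "cyc_ord n 0 (cq j)"
      using evals_cq[OF n] p by (auto intro: cyc_ord_0I)
    from p(4) have "cyc_ord n 3 (cq i * cq j)"
    proof
      assume "m < i"
      hence "cyc_ord n 3 (cq i)" using p by (intro cyc_ord_cq_3 n) (simp_all add: m_def)
      from cyc_ord_mult[OF this 0(2)] show ?thesis by simp
    next
      assume "m < j"
      hence "cyc_ord n 3 (cq j)" using p by (intro cyc_ord_cq_3 n) (simp_all add: m_def)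
      from cyc_ord_mult[OF 0(1) this] show ?thesis by simp
    qed
    thus "cyc_ord n 3 (case p of (i, j) \<Rightarrow> cq i * cq j)" using p by simp
  qed
  ultimately show ?thesis unfolding m_def by simp
qed

section \<open>Expansion of the deformed sum and its value at a = q^n\<close>

lemma evals_coeff_prod:
  assumes "\<And>k i. evals n (coeff (P k) i) (\<lambda>z. coeff (R k z) i)"
  shows "evals n (coeff (\<Prod>k<m::nat. P k) i) (\<lambda>z. coeff (\<Prod>k<m. R k z) i)"
proof (induction m arbitrary: i)
  case 0 show ?case by (cases "i = 0") (simp_all add: evals_0 evals_1)
next
  case (Suc m)
  show ?case unfolding prod.lessThan_Suc coeff_mult
    by (intro evals_sum evals_mult Suc assms)
qed

text \<open>This carries statements about the complex polynomial at \<open>z\<close> over to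
  congruences for the polynomial over the rational functions.\<close>

lemma evals_coeff_whipple_poly:
  assumes n: "n > 0" "odd n" and M: "M < n"
  shows "evals n (coeff (whipple_poly q M) i) (\<lambda>z. coeff (whipple_poly z M) i)"
  unfolding whipple_poly_def coeff_sum coeff_smult
proof (intro evals_sum evals_mult evals_whipple_weight evals_coeff_prod n)
  fix k i :: nat
  show "evals n (coeff [:(1 - q ^ (2*k+1))^2, - (q ^ (2*k+1)):] i) (\<lambda>z. coeff [:(1 - z ^ (2*k+1))^2, - (z ^ (2*k+1)):] i)"
  proof (cases i)
    case 0 thus ?thesis by (simp only: coeff_pCons_0) (intro evals_power evals_diff evals_1 evals_q)
  next
    case (Suc j) thus ?thesis
      by (cases j) (simp_all only: coeff_pCons_0 coeff_pCons_Suc coeff_0, (intro evals_uminus evals_power evals_0 evals_q)+)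
  qed
qed (use M in auto)

text \<open>For \<open>u\<close> of valuation 2 the last term drops out modulo the cube, since
  \<open>R\<close> is regular: its coefficients are coefficients of the polynomial itself.\<close>

lemma poly_whipple_poly_expand:
  assumes n: "n > 0" "odd n" and M: "M < n" and u: "evals n u f"
  obtains R where "cyc_ord n 0 R"
    "poly (whipple_poly q M) u = coeff (whipple_poly q M) 0 + u * coeff (whipple_poly q M) 1 + u^2 * R"
proof -
  obtain c0 c1 R where P: "whipple_poly q M = pCons c0 (pCons c1 R)" by (metis pCons_cases)
  have "coeff R i = coeff (whipple_poly q M) (Suc (Suc i))" for i unfolding P by simp
  hence "evals n (coeff R i) (\<lambda>z. coeff (whipple_poly z M) (Suc (Suc i)))" for i
    using evals_coeff_whipple_poly[OF n M] by simp
  hence "evals n (poly R u) (\<lambda>z. \<Sum>i\<le>degree R. coeff (whipple_poly z M) (Suc (Suc i)) * f z ^ i)"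
    unfolding poly_altdef by (intro evals_sum evals_mult evals_power u)
  from that[OF cyc_ord_0I[OF this]] show ?thesis
    unfolding P by (simp add: algebra_simps power2_eq_square)
qed

text \<open>At a = q^n the parameter a q is Q^(m+1) with Q = q^2. Its exponent is 2r+1 for n = 4r+1
  and 2r+2 for n = 4r+3, which selects the closed form.\<close>

lemma whipple_sum_value_at_q_power:
  fixes n :: nat
  defines "m \<equiv> (n - 1) div 2"
  assumes n: "n > 0" "odd n"
  shows "n mod 4 = 1 \<Longrightarrow> poly (whipple_poly q m) ((1 - q ^ n)^2 / q ^ n) =
      (qpoch (q^2) (q^4) ((n - 1) div 4))^2 / (qpoch (q^4) (q^4) ((n - 1) div 4))^2 * q ^ ((n - 1) div 2)"
    and "n mod 4 = 3 \<Longrightarrow> poly (whipple_poly q m) ((1 - q ^ n)^2 / q ^ n) = 0"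
proof -
  have m: "2 * m + 1 = n" using n by (auto simp: m_def elim!: oddE)
  have "q ^ n * q = q ^ (2 * (m + 1))" unfolding m[symmetric] by simp
  hence e: "poly (whipple_poly q m) ((1 - q ^ n)^2 / q ^ n) = whipple_sum (q^2) ((q^2) ^ (m + 1)) m"
    by (subst poly_whipple_poly) (simp_all only: q_nonzero power_not_zero power_mult simp_thms not_False_eq_True)
  have nz: "(q^2) ^ i \<noteq> 1" if "0 < i" for i using that by (simp flip: power_mult)
  {
    assume "n mod 4 = 1"
    define r where "r = (n - 1) div 4"
    have r: "m = 2 * r" using \<open>n mod 4 = 1\<close> m unfolding r_def by presburger
    show "poly (whipple_poly q m) ((1 - q ^ n)^2 / q ^ n) =
      (qpoch (q^2) (q^4) ((n - 1) div 4))^2 / (qpoch (q^4) (q^4) ((n - 1) div 4))^2 * q ^ ((n - 1) div 2)"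
      unfolding e unfolding m_def[symmetric] r_def[symmetric] unfolding r
      using whipple_sum_even[of "q^2" "2 * r" r] nz by (simp add: power_divide flip: power_mult)
  }
  {
    assume "n mod 4 = 3"
    define r where "r = (n - 1) div 4"
    have r: "m = 2 * r + 1" using \<open>n mod 4 = 3\<close> m unfolding r_def by presburger
    show "poly (whipple_poly q m) ((1 - q ^ n)^2 / q ^ n) = 0"
      unfolding e unfolding r using whipple_sum_odd[of "q^2" "2 * r + 1" r] nz by simp
  }
qed

lemma cyc_ord_one_minus_q_power: "n > 0 \<Longrightarrow> cyc_ord n 1 (1 - q ^ n)"
  by (rule cyc_ord_1I[where f = "\<lambda>z. 1 - z ^ n"])
     (auto intro!: evals_diff evals_1 evals_power evals_q simp: primitive_roots_def)

lemma evals_deformation: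
  "n > 0 \<Longrightarrow> evals n ((1 - q ^ n)^2 / q ^ n) (\<lambda>z. (1 - z ^ n)^2 / z ^ n)"
  by (intro evals_divide evals_power evals_diff evals_1 evals_q) (auto dest: primitive_roots_nonzero)

lemma cyc_ord_deformation:
  assumes "n > 0"
  shows "cyc_ord n 2 ((1 - q ^ n)^2 / q ^ n)"
proof -
  have t: "cyc_ord n 1 (1 - q ^ n)" by (rule cyc_ord_one_minus_q_power[OF assms])
  have "evals n (1 / q ^ n) (\<lambda>z. 1 / z ^ n)"
    using assms by (intro evals_divide evals_power evals_1 evals_q) (auto dest: primitive_roots_nonzero)
  from cyc_ord_mult[OF cyc_ord_mult[OF t t] cyc_ord_0I[OF this]]
  show ?thesis by (simp add: power2_eq_square numeral_2_eq_2)
qed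

lemma qint_eq: "m > 0 \<Longrightarrow> qint m = (1 - q ^ m) / (1 - q)"
  unfolding qint_def using q_power_eq_1_iff[of 1] by (subst sum_gp_strict) auto

text \<open>Modulo the cube, C^2 is S^2 (1 - 4uX) and t^2 is u, while (1 - 4uX)(1 + 4uX) is 1. The
  relation \<open>u - t^2 = t * u\<close> encodes u = t^2/(1 - t).\<close>

lemma cyc_ord_square_congruence:
  assumes reg: "cyc_ord n 0 S" "cyc_ord n 0 X" and t: "cyc_ord n 1 t" and u: "cyc_ord n 2 u" "u - t^2 = t * u"
    and C: "cyc_ord n 3 (C - S * (1 - 2 * u * X))"
  shows "cyc_ord n 3 (S^2 - C^2 * (1 + 4 * t^2 * X))"
proof -
  have reg0: "cyc_ord n 0 1" "cyc_ord n 0 (2 :: rat poly fract)"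
    using cyc_ord_0I[OF evals_1] cyc_ord_0I[OF evals_add[OF evals_1 evals_1]] by simp_all
  note mult0 = cyc_ord_mult[where i = 0 and j = 0, simplified]
  have tu0: "cyc_ord n 0 t" "cyc_ord n 0 u" using t u cyc_ord_mono by blast+
  note r = mult0 cyc_ord_add cyc_ord_diff reg reg0 tu0
  define e where "e = C - S * (1 - 2 * u * X)"
  have e: "cyc_ord n 3 e" using C by (simp add: e_def)
  have e0: "cyc_ord n 0 e" using e cyc_ord_mono by blast
  have tu: "cyc_ord n 3 (t * u)" "cyc_ord n 3 (u * u)"
    using cyc_ord_mult[OF t u(1)] cyc_ord_mono[OF cyc_ord_mult[OF u(1) u(1)], of 3] by (simp_all add: numeral_3_eq_3)
  have l: "cyc_ord n 3 (x * y)" if "cyc_ord n 3 x" "cyc_ord n 0 y" for x y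
    using cyc_ord_mult[OF that] by simp
  have C': "C = S * (1 - 2 * u * X) + e" by (simp add: e_def)
  have t2: "t^2 = u - t * u" using u(2) by (simp add: algebra_simps)
  \<comment> \<open>Each group has a factor \<open>t * u\<close>, \<open>u * u\<close> or
    \<open>e\<close> of order at least 3. Numerals are built from 1 and 2, whose regularity is in
    \<open>reg0\<close>.\<close>
  have "S^2 - C^2 * (1 + 4 * t^2 * X) =
     (t * u) * (2 * 2 * X * (S * (1 - 2 * u * X)) * (S * (1 - 2 * u * X)))
     + (u * u) * (2 * 2 * S * S * X * X * (1 + 2 + - 2 * 2 * u * X))
     - e * ((2 * S * (1 - 2 * u * X) + e) * (1 + 2 * 2 * (u - t * u) * X))"
    unfolding C' t2 by algebra
  moreover have "cyc_ord n 3 \<dots>"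
    by (intro cyc_ord_add cyc_ord_diff l tu e r e0 cyc_ord_uminus)
  ultimately show ?thesis by simp
qed

text \<open>Modulo the cube, C is S + u S1. As u has order 2, S1 matters only modulo the first
  power, where its values at roots of unity give -2XS.\<close>

lemma partial_sum_square_cong_1_mod_4:
  assumes n: "n > 0" "n mod 4 = 1"
  defines "S \<equiv> \<Sum>k\<le>(n - 1) div 2. cq k" and "X \<equiv> \<Sum>k=1..(n - 1) div 4. q ^ (4*k-2) / (1 - q ^ (4*k-2))^2"
    and "C \<equiv> (qpoch (q^2) (q^4) ((n - 1) div 4))^2 / (qpoch (q^4) (q^4) ((n - 1) div 4))^2 * q ^ ((n - 1) div 2)"
  shows "cyc_ord n 3 (S^2 - C^2 * (1 + 4 * (1 - q ^ n)^2 * X))"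
proof -
  have "odd n" using n(2) by presburger
  define m where "m = (n - 1) div 2"
  define r where "r = (n - 1) div 4"
  have nr: "n = 4 * r + 1" "m = 2 * r" using n unfolding r_def m_def by presburger+
  have mn: "m < n" using nr by simp
  define t where "t = 1 - q ^ n"
  define u where "u = t^2 / q ^ n"
  have t: "cyc_ord n 1 t" unfolding t_def by (rule cyc_ord_one_minus_q_power[OF n(1)])
  have evu: "evals n u (\<lambda>z. (1 - z ^ n)^2 / z ^ n)" and u: "cyc_ord n 2 u" unfolding u_def t_def
    by (rule evals_deformation[OF n(1)], rule cyc_ord_deformation[OF n(1)])
  have ut: "u - t^2 = t * u"
    by (simp add: u_def t_def field_simps)
  define S1 where "S1 = coeff (whipple_poly q m) 1"
  have S: "coeff (whipple_poly q m) 0 = S"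
    by (simp add: coeff_0_whipple_poly S_def m_def cq_eq)
  have evX: "evals n X (\<lambda>z. \<Sum>k=1..r. z ^ (4*k-2) / (1 - z ^ (4*k-2))^2)"
    unfolding X_def r_def[symmetric]
  proof (intro evals_sum evals_divide evals_power evals_diff evals_1 evals_q n)
    fix k assume k: "k \<in> {1..r}"
    thus "(1 - q ^ (4*k-2))^2 \<noteq> 0" by auto
    fix z assume z: "z \<in> primitive_roots n"
    have "0 < 4*k-2" "4*k-2 < n" using k unfolding nr atLeastAtMost_iff by linarith+
    thus "(1 - z ^ (4*k-2))^2 \<noteq> 0" using z by (auto simp: primitive_roots_def)
  qed
  note evc = evals_coeff_whipple_poly[OF n(1) \<open>odd n\<close> mn]
  have ev2: "evals n 2 (\<lambda>z. 2)" using evals_add[OF evals_1 evals_1, of n] by simp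
  have S1: "cyc_ord n 1 (S1 + 2 * X * S)"
    unfolding S1_def S[symmetric]
  proof (rule cyc_ord_1I[OF n(1) evals_add[OF evc evals_mult[OF evals_mult[OF ev2 evX] evc]]])
    fix z assume "z \<in> primitive_roots n"
    thus "coeff (whipple_poly z m) 1 + 2 * (\<Sum>k=1..r. z ^ (4*k-2) / (1 - z ^ (4*k-2))^2) * coeff (whipple_poly z m) 0 = 0"
      using coeff_1_whipple_poly_root_of_unity[of z r] unfolding nr by simp
  qed
  obtain R where R: "cyc_ord n 0 R" "poly (whipple_poly q m) u = S + u * S1 + u^2 * R"
    using poly_whipple_poly_expand[OF n(1) \<open>odd n\<close> mn evu] unfolding S S1_def by blast
  have C: "poly (whipple_poly q m) u = C"
    unfolding u_def t_def C_def m_def by (rule whipple_sum_value_at_q_power(1)[OF n(1) \<open>odd n\<close> n(2)])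
  have "C - S * (1 - 2 * u * X) = u * (S1 + 2 * X * S) + u * u * R"
    using R(2) unfolding C by (simp add: algebra_simps power2_eq_square)
  moreover have "cyc_ord n 3 (u * (S1 + 2 * X * S))"
    using cyc_ord_mult[OF u S1] by (simp add: numeral_3_eq_3)
  moreover have "cyc_ord n 3 (u * u * R)"
    using cyc_ord_mono[OF cyc_ord_mult[OF cyc_ord_mult[OF u u] R(1)], of 3] by simp
  ultimately have "cyc_ord n 3 (C - S * (1 - 2 * u * X))" by (simp add: cyc_ord_add)
  thus ?thesis unfolding t_def[symmetric]
    using evc[of 0] unfolding S by (intro cyc_ord_square_congruence[OF _ _ t u ut] cyc_ord_0I[OF evX]) (rule cyc_ord_0I)
qed

text \<open>The closed form is 0, so S is a multiple of u and has order 2; its square has order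
  4.\<close>

lemma partial_sum_square_cong_3_mod_4:
  assumes n: "n > 0" "n mod 4 = 3"
  shows "cyc_ord n 3 ((\<Sum>k\<le>(n - 1) div 2. cq k)^2)"
proof -
  have "odd n" using n(2) by presburger
  define m where "m = (n - 1) div 2"
  have mn: "m < n" using n unfolding m_def by linarith
  define S where "S = (\<Sum>k\<le>m. cq k)"
  define u where "u = (1 - q ^ n)^2 / q ^ n"
  have evu: "evals n u (\<lambda>z. (1 - z ^ n)^2 / z ^ n)" and u: "cyc_ord n 2 u" unfolding u_def
    by (rule evals_deformation[OF n(1)], rule cyc_ord_deformation[OF n(1)])
  have S: "coeff (whipple_poly q m) 0 = S"
    by (simp add: coeff_0_whipple_poly S_def cq_eq)
  obtain R where R: "cyc_ord n 0 R" "poly (whipple_poly q m) u = S + u * coeff (whipple_poly q m) 1 + u^2 * R"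
    using poly_whipple_poly_expand[OF n(1) \<open>odd n\<close> mn evu] unfolding S by blast
  have "poly (whipple_poly q m) u = 0"
    unfolding u_def m_def by (rule whipple_sum_value_at_q_power(2)[OF n(1) \<open>odd n\<close> n(2)])
  hence "S = - (u * (coeff (whipple_poly q m) 1 + u * R))"
    using R(2) by (simp add: algebra_simps power2_eq_square eq_neg_iff_add_eq_0)
  moreover have "cyc_ord n 0 (coeff (whipple_poly q m) 1 + u * R)"
    using cyc_ord_0I[OF evals_coeff_whipple_poly[OF n(1) \<open>odd n\<close> mn, of 1]] cyc_ord_mult[OF cyc_ord_0I[OF evu] R(1)]
    by (simp add: cyc_ord_add)
  hence "cyc_ord n 2 (- (u * (coeff (whipple_poly q m) 1 + u * R)))"
    using cyc_ord_uminus[OF cyc_ord_mult[OF u]] by (metis add_0_right)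
  ultimately have "cyc_ord n 2 S" by simp
  from cyc_ord_mono[OF cyc_ord_mult[OF this this], of 3] show ?thesis
    by (simp add: S_def m_def power2_eq_square)
qed

theorem theorem5p2:
  fixes n :: nat
  assumes "n > 0" and "odd n"
  shows "(n mod 4 = 1 \<longrightarrow>
            qcong (\<Sum>k = 0..n - 1. \<Sum>j = 0..k. cq j * cq (k - j))
                  ((qpoch (q^2) (q^4) ((n - 1) div 4))^4 / (qpoch (q^4) (q^4) ((n - 1) div 4))^4
                     * q ^ (n - 1)
                     * (1 + 4 * (qint n)^2
                          * (\<Sum>k = 1..(n - 1) div 4. q ^ (4 * k - 2) / (qint (4 * k - 2))^2)))
                  ((cyclotomic n)^3)) \<and>
         (n mod 4 = 3 \<longrightarrow>
            qcong (\<Sum>k = 0..n - 1. \<Sum>j = 0..k. cq j * cq (k - j)) 0 ((cyclotomic n)^3))"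
proof (intro conjI impI)
  assume 1: "n mod 4 = 1"
  let ?S = "(\<Sum>k\<le>(n - 1) div 2. cq k)"
  let ?X = "\<Sum>k=1..(n - 1) div 4. q ^ (4*k-2) / (1 - q ^ (4*k-2))^2"
  let ?C = "(qpoch (q^2) (q^4) ((n - 1) div 4))^2 / (qpoch (q^4) (q^4) ((n - 1) div 4))^2 * q ^ ((n - 1) div 2)"
  have q1: "1 - q \<noteq> 0" using q_power_eq_1_iff[of 1] by simp
  \<comment> \<open>The factors 1 - q in the denominators of [n] and [4k-2] cancel.\<close>
  have "(qint n)^2 * (\<Sum>k = 1..(n - 1) div 4. q ^ (4 * k - 2) / (qint (4 * k - 2))^2) = (1 - q ^ n)^2 * ?X"
    unfolding sum_distrib_left
  proof (intro sum.cong refl)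
    fix k assume "k \<in> {1..(n - 1) div 4}"
    hence k: "4 * k - 2 > 0" by auto
    show "(qint n)^2 * (q ^ (4 * k - 2) / (qint (4 * k - 2))^2) = (1 - q ^ n)^2 * (q ^ (4 * k - 2) / (1 - q ^ (4 * k - 2))^2)"
      unfolding qint_eq[OF k] qint_eq[OF assms(1)] using q1 by (simp add: power_divide)
  qed
  hence X: "4 * (qint n)^2 * (\<Sum>k = 1..(n - 1) div 4. q ^ (4 * k - 2) / (qint (4 * k - 2))^2) = 4 * (1 - q ^ n)^2 * ?X"
    by (simp only: mult.assoc)
  have "2 * ((n - 1) div 2) = n - 1" using assms by (auto elim!: oddE)
  hence "(q ^ ((n - 1) div 2))^2 = q ^ (n - 1)" by (simp add: mult.commute flip: power_mult)
  hence C: "(qpoch (q^2) (q^4) ((n - 1) div 4))^4 / (qpoch (q^4) (q^4) ((n - 1) div 4))^4 * q ^ (n - 1) = ?C^2"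
    by (simp add: power_mult_distrib power_divide flip: power_mult)
  show "qcong (\<Sum>k = 0..n - 1. \<Sum>j = 0..k. cq j * cq (k - j))
                  ((qpoch (q^2) (q^4) ((n - 1) div 4))^4 / (qpoch (q^4) (q^4) ((n - 1) div 4))^4
                     * q ^ (n - 1)
                     * (1 + 4 * (qint n)^2
                          * (\<Sum>k = 1..(n - 1) div 4. q ^ (4 * k - 2) / (qint (4 * k - 2))^2)))
                  ((cyclotomic n)^3)"
    unfolding X C
    using cyc_ord_add[OF double_sum_cong[OF assms] partial_sum_square_cong_1_mod_4[OF assms(1) 1]]
    by (intro qcongI assms(1)) simp
next
  assume 3: "n mod 4 = 3"
  show "qcong (\<Sum>k = 0..n - 1. \<Sum>j = 0..k. cq j * cq (k - j)) 0 ((cyclotomic n)^3)"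
    using cyc_ord_add[OF double_sum_cong[OF assms] partial_sum_square_cong_3_mod_4[OF assms(1) 3]]
    by (intro qcongI assms(1)) simp
qed

end
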